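(* Let $(\mathfrak g,g,J)$ be a $2n$-dimensional almost Hermitian two-step solvable Lie algebra with totally real $m$-dimensional commutator ideal $\mathfrak g'$ such that $[\mathfrak g',J\mathfrak g']$ has codimension $\ell\in\{1,2\}$ in $\mathfrak g'$. Set $U_J:=(\mathfrak g'\oplus J\mathfrak g')^\perp$. (a) If $\ell=1$, then $(\mathfrak g,g,J)$ is SKT if and only if there exist an orthonormal basis $(X_1,\dots,X_m)$ of $\mathfrak g'$, $\lambda_1,\dots,\lambda_{m-1}\in\mathbb R\setminus\{0\}$ and $\mu_1,\dots,\mu_{m-1},\alpha\in U_J^*$ with $\alpha\ne0$ such that the only non-zero Lie brackets (up to anti-symmetry) are given by $$[JX_i,X_i]=\lambda_iX_i,\quad [Y,X_i]=\mu_i(Y)X_i,\quad [Y,JX_i]=-\mu_i(JY)X_i,$$ $$[Y,Z]=\sum_{i=1}^{m-1}\frac1{\lambda_i}(\mu_i\wedge\mu_i\circ J)(Y,Z)X_i+(\alpha\wedge J^*\alpha)(Y,Z)X_m$$ for $i=1,\dots,m-1$, $Y,Z\in U_J$. In this case, $\mathfrak g\cong(m-1)\,\mathfrak{aff}_{\mathbb R}\oplus\mathfrak h_3\oplus\mathbb R^{2n-2m-1}$. (b) If $\ell=2$, then $(\mathfrak g,g,J)$ is SKT if and only if there exist an orthonormal basis $(X_1,\dots,X_m)$ of $\mathfrak g'$, $\lambda_1,\dots,\lambda_{m-2}\in\mathbb R\setminus\{0\}$ and $\mu_1,\dots,\mu_{m-2},\alpha_1,\alpha_2\in U_J^*$ with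 $\alpha_1,\alpha_2$ being $\mathbb C$-linearly independent such that the only non-zero Lie brackets (up to anti-symmetry) are given by $$[JX_i,X_i]=\lambda_iX_i,\quad [Y,X_i]=\mu_i(Y)X_i,\quad [Y,JX_i]=-\mu_i(JY)X_i,$$ $$[Y,Z]=\sum_{i=1}^{m-2}\frac1{\lambda_i}(\mu_i\wedge\mu_i\circ J)(Y,Z)X_i+\sum_{i=1}^2(\alpha_i\wedge J^*\alpha_i)(Y,Z)X_{m-2+i}$$ for $i=1,\dots,m-2$, $Y,Z\in U_J$. In this case, $\mathfrak g\cong(m-2)\,\mathfrak{aff}_{\mathbb R}\oplus2\mathfrak h_3\oplus\mathbb R^{2n-2m-2}$.
   Context: An almost Hermitian Lie algebra $(\mathfrak g,g,J)$ is a finite-dimensional real Lie algebra with an inner product $g$ and an endomorphism $J$, $J^2=-\mathrm{id}$, with $g(J\cdot,J\cdot)=g$; put $\sigma=g(J\cdot,\cdot)$. It is SKT if $J$ is integrable ($[JX,JY]-J[JX,Y]-J[X,JY]-[X,Y]=0$) and $d(J^*d\sigma)=0$, where $d$ is the Chevalley–Eilenberg differential and $(J^*\beta)(X_1,\dots,X_k)=\beta(JX_1,\dots,JX_k)$; in particular $J^*\alpha=\alpha\circ J$ for one-forms. $\mathfrak g'=[\mathfrak g,\mathfrak g]$; two-step solvable means $\mathfrak g'$ is Abelian; $\mathfrak g'$ is totally real if $\mathfrak g'\cap J\mathfrak g'=\{0\}$. $[\mathfrak g',J\mathfrak g']$ is the linear span of the brackets. Wedge convention: $(\alpha\wedge\beta)(Y,Z)=\alpha(Y)\beta(Z)-\alpha(Z)\beta(Y)$.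 $\mathbb C$-linear independence in $U_J^*$ is with respect to the complex structure $J^*$. $\mathfrak{aff}_{\mathbb R}$ is the two-dimensional non-Abelian Lie algebra, $\mathfrak h_3$ the three-dimensional Heisenberg algebra, and $k\,\mathfrak k$ denotes the direct sum of $k$ copies of $\mathfrak k$. *)

theory Defs
  imports "HOL-Analysis.Analysis" "HOL-Library.Function_Algebras"
begin

section \<open>Lie algebras carried by subspaces of real vector spaces\<close>

text \<open>Carriers are subspaces of a type, rather than whole types, so that the number of summands
  in a direct sum can depend on a natural number.\<close>

record 'v lie_alg =
  lie_carrier :: "'v set"
  lie_bracket :: "'v \<Rightarrow> 'v \<Rightarrow> 'v"

locale lie_algebra =
  fixes L :: "'v::real_vector lie_alg"
  assumes carrier_subspace: "subspace (lie_carrier L)"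
    and bracket_closed: "\<And>x y. x \<in> lie_carrier L \<Longrightarrow> y \<in> lie_carrier L \<Longrightarrow>
      lie_bracket L x y \<in> lie_carrier L"
    and bracket_add_left: "\<And>x y z. x \<in> lie_carrier L \<Longrightarrow> y \<in> lie_carrier L \<Longrightarrow> z \<in> lie_carrier L \<Longrightarrow>
      lie_bracket L (x + y) z = lie_bracket L x z + lie_bracket L y z"
    and bracket_add_right: "\<And>x y z. x \<in> lie_carrier L \<Longrightarrow> y \<in> lie_carrier L \<Longrightarrow> z \<in> lie_carrier L \<Longrightarrow>
      lie_bracket L x (y + z) = lie_bracket L x y + lie_bracket L x z"
    and bracket_scale_left: "\<And>c x y. x \<in> lie_carrier L \<Longrightarrow> y \<in> lie_carrier L \<Longrightarrow>
      lie_bracket L (c *\<^sub>R x) y = c *\<^sub>R lie_bracket L x y"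
    and bracket_scale_right: "\<And>c x y. x \<in> lie_carrier L \<Longrightarrow> y \<in> lie_carrier L \<Longrightarrow>
      lie_bracket L x (c *\<^sub>R y) = c *\<^sub>R lie_bracket L x y"
    and bracket_self: "\<And>x. x \<in> lie_carrier L \<Longrightarrow> lie_bracket L x x = 0"
    and jacobi: "\<And>x y z. x \<in> lie_carrier L \<Longrightarrow> y \<in> lie_carrier L \<Longrightarrow> z \<in> lie_carrier L \<Longrightarrow>
      lie_bracket L x (lie_bracket L y z) + lie_bracket L y (lie_bracket L z x)
        + lie_bracket L z (lie_bracket L x y) = 0"

definition lie_structure :: "('v \<Rightarrow> 'v \<Rightarrow> 'v) \<Rightarrow> 'v lie_alg"
  where "lie_structure br = \<lparr>lie_carrier = UNIV, lie_bracket = br\<rparr>"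

text \<open>Requiring the map to be linear on the whole type is harmless: a linear map on a subspace
  always extends.\<close>

definition lie_isomorphic :: "'v::real_vector lie_alg \<Rightarrow> 'w::real_vector lie_alg \<Rightarrow> bool"
    (infix \<open>\<cong>\<^sub>L\<close> 50)
  where "L \<cong>\<^sub>L M \<longleftrightarrow> (\<exists>f. linear f \<and> bij_betw f (lie_carrier L) (lie_carrier M) \<and>
    (\<forall>x\<in>lie_carrier L. \<forall>y\<in>lie_carrier L.
      f (lie_bracket L x y) = lie_bracket M (f x) (f y)))"

definition lie_sum :: "'v lie_alg \<Rightarrow> 'w lie_alg \<Rightarrow> ('v \<times> 'w) lie_alg" (infixr \<open>\<oplus>\<^sub>L\<close> 65)
  where "L \<oplus>\<^sub>L M = \<lparr>lie_carrier = lie_carrier L \<times> lie_carrier M,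
    lie_bracket = (\<lambda>p q. (lie_bracket L (fst p) (fst q), lie_bracket M (snd p) (snd q)))\<rparr>"

text \<open>Pointwise scalar multiplication; addition comes from \<^theory>\<open>HOL-Library.Function_Algebras\<close>.\<close>

instantiation "fun" :: (type, real_vector) real_vector
begin

definition scaleR_fun :: "real \<Rightarrow> ('a \<Rightarrow> 'b) \<Rightarrow> 'a \<Rightarrow> 'b"
  where "scaleR_fun c f = (\<lambda>x. c *\<^sub>R f x)"

instance
  by standard (auto simp: scaleR_fun_def fun_eq_iff scaleR_right_distrib scaleR_left_distrib)

end

definition lie_copies :: "nat \<Rightarrow> 'v::real_vector lie_alg \<Rightarrow> (nat \<Rightarrow> 'v) lie_alg"
  where "lie_copies k L =
    \<lparr>lie_carrier = {f. (\<forall>i<k. f i \<in> lie_carrier L) \<and> (\<forall>i\<ge>k. f i = 0)},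
     lie_bracket = (\<lambda>f g i. lie_bracket L (f i) (g i))\<rparr>"

text \<open>With the standard bases: \<open>[e\<^sub>1, e\<^sub>2] = e\<^sub>2\<close> in the affine algebra and \<open>[e\<^sub>1, e\<^sub>2] = e\<^sub>3\<close> in the
  Heisenberg algebra.\<close>

definition aff_real :: "(real \<times> real) lie_alg"
  where "aff_real = lie_structure (\<lambda>(a, b) (c, d). (0, a * d - b * c))"

definition heisenberg3 :: "(real \<times> real \<times> real) lie_alg"
  where "heisenberg3 = lie_structure (\<lambda>(a, b, c) (a', b', c'). (0, 0, a * b' - b * a'))"

definition abelian_real :: "real lie_alg"
  where "abelian_real = lie_structure (\<lambda>x y. 0)"

lemma lie_algebra_aff_real: "lie_algebra aff_real"
  by unfold_locales
    (auto simp: aff_real_def lie_structure_def case_prod_beta algebra_simps zero_prod_def)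

lemma lie_algebra_heisenberg3: "lie_algebra heisenberg3"
  by unfold_locales
    (auto simp: heisenberg3_def lie_structure_def case_prod_beta algebra_simps zero_prod_def)

lemma lie_algebra_abelian_real: "lie_algebra abelian_real"
  by unfold_locales (auto simp: abelian_real_def lie_structure_def)

lemma lie_algebra_sum:
  assumes "lie_algebra L" "lie_algebra M"
  shows "lie_algebra (L \<oplus>\<^sub>L M)"
proof -
  interpret L: lie_algebra L by fact
  interpret M: lie_algebra M by fact
  show ?thesis
    by unfold_locales
      (auto simp: lie_sum_def zero_prod_def subspace_Times L.carrier_subspace M.carrier_subspace
        L.bracket_closed M.bracket_closed L.bracket_add_left M.bracket_add_left
        L.bracket_add_right M.bracket_add_right L.bracket_scale_left M.bracket_scale_left
        L.bracket_scale_right M.bracket_scale_right L.bracket_self M.bracket_self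
        L.jacobi M.jacobi)
qed

lemma lie_algebra_copies:
  assumes "lie_algebra L"
  shows "lie_algebra (lie_copies k L)"
proof -
  interpret L: lie_algebra L by fact
  have mem: "f i \<in> lie_carrier L" if "f \<in> lie_carrier (lie_copies k L)" for f i
    using that subspace_0[OF L.carrier_subspace]
    by (cases "i < k") (auto simp: lie_copies_def)
  have br: "lie_bracket (lie_copies k L) f g = (\<lambda>i. lie_bracket L (f i) (g i))" for f g
    by (simp add: lie_copies_def)
  show ?thesis
  proof unfold_locales
    show "subspace (lie_carrier (lie_copies k L))"
      using L.carrier_subspace
      by (auto simp: lie_copies_def subspace_def scaleR_fun_def)
  next
    fix x y assume "x \<in> lie_carrier (lie_copies k L)" "y \<in> lie_carrier (lie_copies k L)"
    then show "lie_bracket (lie_copies k L) x y \<in> lie_carrier (lie_copies k L)"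
      using L.bracket_closed L.bracket_self[OF subspace_0[OF L.carrier_subspace]]
      by (auto simp: lie_copies_def)
  qed (auto simp: br fun_eq_iff scaleR_fun_def mem L.bracket_add_left L.bracket_add_right
        L.bracket_scale_left L.bracket_scale_right L.bracket_self L.jacobi)
qed

section \<open>Almost Hermitian Lie algebras and the SKT condition\<close>

text \<open>The inner product is the one of the Euclidean space carrying the Lie algebra.\<close>

locale almost_hermitian_lie_algebra = lie_algebra "lie_structure br"
  for br :: "'a::euclidean_space \<Rightarrow> 'a \<Rightarrow> 'a" +
  fixes J :: "'a \<Rightarrow> 'a"
  assumes linear_J: "linear J"
    and J_J: "\<And>x. J (J x) = - x"
    and inner_J_J: "\<And>x y. J x \<bullet> J y = x \<bullet> y"

text \<open>A \<open>k\<close>-form is represented by its values on lists of vectors of length \<open>k\<close>. The differential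
  is the Chevalley--Eilenberg differential with trivial coefficients,
  \<open>d\<beta>(X\<^sub>0,\<dots>,X\<^sub>k) = \<Sum>\<^sub>i\<^sub><\<^sub>j (-1)\<^sup>i\<^sup>+\<^sup>j \<beta>([X\<^sub>i,X\<^sub>j], X\<^sub>0,\<dots>,\<close> omit \<open>X\<^sub>i\<close>, omit \<open>X\<^sub>j\<close> \<open>,\<dots>,X\<^sub>k)\<close>.\<close>

definition ce_diff :: "('a \<Rightarrow> 'a \<Rightarrow> 'a) \<Rightarrow> ('a list \<Rightarrow> real) \<Rightarrow> 'a list \<Rightarrow> real"
  where "ce_diff br \<beta> Xs = (\<Sum>j<length Xs. \<Sum>i<j.
    (- 1) ^ (i + j) * \<beta> (br (Xs ! i) (Xs ! j) # nths Xs (- {i, j})))"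

lemma ce_diff_one_form: "ce_diff br \<beta> [X, Y] = - \<beta> [br X Y]"
  by (simp add: ce_diff_def nths_Cons numeral_eq_Suc)

lemma ce_diff_two_form:
  "ce_diff br \<beta> [X, Y, Z] = - \<beta> [br X Y, Z] + \<beta> [br X Z, Y] - \<beta> [br Y Z, X]"
  by (simp add: ce_diff_def nths_Cons numeral_eq_Suc)

definition form_pullback :: "('a \<Rightarrow> 'a) \<Rightarrow> ('a list \<Rightarrow> real) \<Rightarrow> 'a list \<Rightarrow> real"
  where "form_pullback J \<beta> Xs = \<beta> (map J Xs)"

definition fundamental_form :: "('a::real_inner \<Rightarrow> 'a) \<Rightarrow> 'a list \<Rightarrow> real"
  where "fundamental_form J Xs = (case Xs of [X, Y] \<Rightarrow> J X \<bullet> Y | _ \<Rightarrow> 0)"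

definition integrable_structure :: "('a::ab_group_add \<Rightarrow> 'a \<Rightarrow> 'a) \<Rightarrow> ('a \<Rightarrow> 'a) \<Rightarrow> bool"
  where "integrable_structure br J \<longleftrightarrow>
    (\<forall>X Y. br (J X) (J Y) - J (br (J X) Y) - J (br X (J Y)) - br X Y = 0)"

definition SKT :: "('a::real_inner \<Rightarrow> 'a \<Rightarrow> 'a) \<Rightarrow> ('a \<Rightarrow> 'a) \<Rightarrow> bool"
  where "SKT br J \<longleftrightarrow> integrable_structure br J \<and>
    (\<forall>Xs. length Xs = 4 \<longrightarrow>
      ce_diff br (form_pullback J (ce_diff br (fundamental_form J))) Xs = 0)"

definition bracket_span :: "('a::real_vector \<Rightarrow> 'a \<Rightarrow> 'a) \<Rightarrow> 'a set \<Rightarrow> 'a set \<Rightarrow> 'a set"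
  where "bracket_span br A B = span {br x y | x y. x \<in> A \<and> y \<in> B}"

definition commutator_ideal :: "('a::real_vector \<Rightarrow> 'a \<Rightarrow> 'a) \<Rightarrow> 'a set"
  where "commutator_ideal br = bracket_span br UNIV UNIV"

definition two_step_solvable :: "('a::real_vector \<Rightarrow> 'a \<Rightarrow> 'a) \<Rightarrow> bool"
  where "two_step_solvable br \<longleftrightarrow>
    (\<forall>x\<in>commutator_ideal br. \<forall>y\<in>commutator_ideal br. br x y = 0)"

definition totally_real :: "('a::zero \<Rightarrow> 'a) \<Rightarrow> 'a set \<Rightarrow> bool"
  where "totally_real J V \<longleftrightarrow> V \<inter> J ` V = {0}"

definition U_J :: "('a::euclidean_space \<Rightarrow> 'a \<Rightarrow> 'a) \<Rightarrow> ('a \<Rightarrow> 'a) \<Rightarrow> 'a set"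
  where "U_J br J =
    {x + J y | x y. x \<in> commutator_ideal br \<and> y \<in> commutator_ideal br}\<^sup>\<bottom>"

section \<open>Linear functionals on a subspace\<close>

text \<open>A functional on \<open>U\<close> is represented by its extension by \<open>0\<close> to the complement of \<open>U\<close> (which is
  not linear on the whole type), so that equality of functionals is equality of functions. For
  \<open>J\<close>-invariant \<open>U\<close>, composition with \<open>J\<close> respects this representation.\<close>

definition dual_space :: "'a::real_vector set \<Rightarrow> ('a \<Rightarrow> real) set"
  where "dual_space U = {\<alpha>. (\<forall>x\<in>U. \<forall>y\<in>U. \<alpha> (x + y) = \<alpha> x + \<alpha> y) \<and>
    (\<forall>c. \<forall>x\<in>U. \<alpha> (c *\<^sub>R x) = c * \<alpha> x) \<and> (\<forall>x. x \<notin> U \<longrightarrow> \<alpha> x = 0)}"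

definition wedge :: "('a \<Rightarrow> real) \<Rightarrow> ('a \<Rightarrow> real) \<Rightarrow> 'a \<Rightarrow> 'a \<Rightarrow> real"
  where "wedge \<alpha> \<beta> Y Z = \<alpha> Y * \<beta> Z - \<alpha> Z * \<beta> Y"

text \<open>Multiplication by \<open>a + b \<i>\<close> for the complex structure \<open>J\<^sup>*\<close>: \<open>a \<alpha> + b J\<^sup>* \<alpha>\<close>.\<close>

definition cscale_form :: "('a \<Rightarrow> 'a) \<Rightarrow> complex \<Rightarrow> ('a \<Rightarrow> real) \<Rightarrow> 'a \<Rightarrow> real"
  where "cscale_form J c \<alpha> = (\<lambda>Y. Re c * \<alpha> Y + Im c * (\<alpha> \<circ> J) Y)"

definition complex_independent :: "('a \<Rightarrow> 'a) \<Rightarrow> 'i set \<Rightarrow> ('i \<Rightarrow> 'a \<Rightarrow> real) \<Rightarrow> bool"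
  where "complex_independent J I \<alpha> \<longleftrightarrow>
    (\<forall>c. (\<Sum>i\<in>I. cscale_form J (c i) (\<alpha> i)) = 0 \<longrightarrow> (\<forall>i\<in>I. c i = 0))"

section \<open>The normal form of the bracket\<close>

definition orthonormal_basis :: "nat \<Rightarrow> (nat \<Rightarrow> 'a::real_inner) \<Rightarrow> 'a set \<Rightarrow> bool"
  where "orthonormal_basis m X V \<longleftrightarrow>
    (\<forall>i\<in>{1..m}. \<forall>j\<in>{1..m}. X i \<bullet> X j = (if i = j then 1 else 0)) \<and> span (X ` {1..m}) = V"

text \<open>All brackets between \<open>X\<^sub>1,\<dots>,X\<^sub>m, J X\<^sub>1,\<dots>,J X\<^sub>m\<close> and \<open>U\<close>, except those of two elements of \<open>U\<close>:
  up to anti-symmetry, only those with \<open>i \<le> k\<close> may be non-zero.\<close>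

definition normal_brackets :: "('a::real_vector \<Rightarrow> 'a \<Rightarrow> 'a) \<Rightarrow> ('a \<Rightarrow> 'a) \<Rightarrow> 'a set \<Rightarrow> nat \<Rightarrow> nat \<Rightarrow>
    (nat \<Rightarrow> 'a) \<Rightarrow> (nat \<Rightarrow> real) \<Rightarrow> (nat \<Rightarrow> 'a \<Rightarrow> real) \<Rightarrow> bool"
  where "normal_brackets br J U m k X lam mu \<longleftrightarrow>
    (\<forall>i\<in>{1..m}. \<forall>j\<in>{1..m}.
      br (X i) (X j) = 0 \<and> br (J (X i)) (J (X j)) = 0 \<and>
      br (J (X i)) (X j) = (if i = j \<and> i \<le> k then lam i *\<^sub>R X i else 0)) \<and>
    (\<forall>Y\<in>U. \<forall>i\<in>{1..m}.
      br Y (X i) = (if i \<le> k then mu i Y *\<^sub>R X i else 0) \<and>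
      br Y (J (X i)) = (if i \<le> k then (- mu i (J Y)) *\<^sub>R X i else 0))"

end

theory Submission
  imports Defs
begin

text \<open>Because \<open>\<gg>'\<close> is totally real, \<open>J\<close> is integrable iff \<open>[J X, J Y] = [X, Y]\<close>, and then the SKT
  condition reads \<open>\<langle>[X,Y],[Z,W]\<rangle> - \<langle>[X,Z],[Y,W]\<rangle> + \<langle>[X,W],[Y,Z]\<rangle> = 0\<close>: componentwise, the squares of
  the two-forms \<open>de\<^sub>i\<close> sum to zero. The product \<open>A * B = [J A, B]\<close> makes \<open>\<gg>'\<close> a commutative associative
  algebra whose multiplications are symmetric on \<open>[\<gg>', J\<gg>']\<close>; a common orthonormal eigenbasis there
  consists, up to scaling, of idempotents and elements of square zero. The SKT identity for
  \<open>(J A, A, Y, J Y)\<close> shows that \<open>A * A = 0\<close> forces \<open>A\<close> and \<open>J A\<close> to be central, which excludes the latter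
  and makes the complement \<open>R\<close> of \<open>[\<gg>', J\<gg>']\<close> in \<open>\<gg>'\<close> central. The vectors \<open>[J X, X]\<^sub>R\<close> pairwise
  form acute angles, so for \<open>dim R \<le> 2\<close> they lie in a quadrant; in the corresponding basis of \<open>R\<close> the
  components of the bracket are semidefinite, and equality in Cauchy--Schwarz makes them of
  the form \<open>\<alpha> \<and> J\<^sup>*\<alpha>\<close>.\<close>

section \<open>The SKT condition for a totally real commutator ideal\<close>

text \<open>The obstacle is that multiplications are symmetric only on \<open>W = [V, J V]\<close>,
  as symmetry concerns inner products of two products, while the action on all of \<open>V\<close>,
  and of the whole algebra on \<open>V\<close>, is wanted. Two facts carry information outwards: an
  eigenvector not of square zero is a multiple of its own square, hence an eigenvector of every
  adjoint map; and \<open>V\<close> is spanned by brackets, on which the Jacobi and SKT identities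
  can be compared. The constants: \<open>X i * X i = lam i X i\<close>; \<open>mu i\<close> is the
  eigenvalue functional of the adjoint action on \<open>X i\<close>, restricted to \<open>U\<close>;
  the factor \<open>1 / lam i\<close> comes from the SKT identity at
  \<open>(J X i, X i, Y, Z)\<close>, whose first term is \<open>lam i\<close> times the
  \<open>X i\<close> component of \<open>[Y, Z]\<close>. The bound on the codimension enters through
  plane geometry: in dimension three a round cone of half-angle 45 degrees has pairwise acute
  vectors and fits into no orthant. The summands of the final decomposition need not be orthogonal,
  so the isomorphism is built from linear functionals instead of orthogonal projections.\<close>

context almost_hermitian_lie_algebra
begin

lemma br_add_left: "br (x + y) z = br x z + br y z"
  and br_add_right: "br x (y + z) = br x y + br x z"
  and br_scaleR_left: "br (c *\<^sub>R x) y = c *\<^sub>R br x y"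
  and br_scaleR_right: "br x (c *\<^sub>R y) = c *\<^sub>R br x y"
  and br_self [simp]: "br x x = 0"
  and br_jacobi: "br x (br y z) + br y (br z x) + br z (br x y) = 0"
  using bracket_add_left bracket_add_right bracket_scale_left bracket_scale_right
    bracket_self jacobi
  by (simp_all add: lie_structure_def)

lemma br_bilinear: "bilinear br"
  by (simp add: bilinear_def linear_iff br_add_left br_add_right br_scaleR_left br_scaleR_right)

lemma linear_br_right: "linear (br x)" and linear_br_left: "linear (\<lambda>x. br x y)"
  using br_bilinear by (simp_all add: bilinear_def)

lemmas br_simps = br_add_left br_add_right br_scaleR_left br_scaleR_right
  linear_0[OF linear_br_right] linear_0[OF linear_br_left]
  linear_neg[OF linear_br_right] linear_neg[OF linear_br_left]
  linear_diff[OF linear_br_right] linear_diff[OF linear_br_left]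

lemmas J_simps = linear_add[OF linear_J] linear_scale[OF linear_J] linear_0[OF linear_J]
  linear_neg[OF linear_J] linear_diff[OF linear_J] J_J

lemma br_swap: "br x y = - br y x"
proof -
  have "br x y + br y x = 0"
    using br_self[of "x + y"] unfolding br_add_left br_add_right by (simp add: add.commute)
  then show ?thesis by (simp add: eq_neg_iff_add_eq_0)
qed

lemma inner_J_left: "J x \<bullet> y = - (x \<bullet> J y)"
  using inner_J_J[of x "J y"] by (simp add: J_simps)

abbreviation V :: "'a set" where "V \<equiv> commutator_ideal br"

lemma subspace_V: "subspace V"
  by (simp add: commutator_ideal_def bracket_span_def)

lemma br_in_V [simp]: "br x y \<in> V"
  unfolding commutator_ideal_def bracket_span_def by (rule span_base) auto

lemma V_induct [consumes 1, case_names base zero add scale]: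
  assumes "v \<in> V" "\<And>x y. P (br x y)" "P 0" "\<And>x y. P x \<Longrightarrow> P y \<Longrightarrow> P (x + y)"
    "\<And>c x. P x \<Longrightarrow> P (c *\<^sub>R x)"
  shows "P v"
proof -
  have "v \<in> span {br x y | x y. x \<in> UNIV \<and> y \<in> UNIV}"
    using assms(1) by (simp add: commutator_ideal_def bracket_span_def)
  then show ?thesis
    by (induction rule: span_induct_alt) (use assms in auto)
qed

text \<open>These are the abelian complex structures: equivalently, the vectors of type (1,0) in the
  complexification commute.\<close>

definition abelian_J :: bool
  where "abelian_J \<longleftrightarrow> (\<forall>X Y. br (J X) (J Y) = br X Y)"

definition cyclic_inner :: bool
  where "cyclic_inner \<longleftrightarrow> (\<forall>X Y Z W.
    br X Y \<bullet> br Z W - br X Z \<bullet> br Y W + br X W \<bullet> br Y Z = 0)"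

text \<open>If \<open>\<gg>'\<close> is totally real, the Nijenhuis identity splits into its \<open>\<gg>'\<close>- and
  \<open>J\<gg>'\<close>-components.\<close>

lemma integrable_iff_abelian_J:
  assumes "totally_real J V"
  shows "integrable_structure br J \<longleftrightarrow> abelian_J"
proof
  assume int: "integrable_structure br J"
  show abelian_J
    unfolding abelian_J_def
  proof (intro allI)
    fix X Y
    let ?d = "br (J X) (J Y) - br X Y"
    have "?d = J (br (J X) Y + br X (J Y))"
      using int by (simp add: integrable_structure_def J_simps algebra_simps)
    moreover have "?d \<in> V" "br (J X) Y + br X (J Y) \<in> V"
      by (simp_all add: subspace_diff subspace_add subspace_V)
    ultimately have "?d \<in> V \<inter> J ` V" by blast
    then have "?d = 0" using assms unfolding totally_real_def by blast
    then show "br (J X) (J Y) = br X Y" by simp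
  qed
next
  assume ab: abelian_J
  have "br (J X) Y = - br X (J Y)" for X Y
    using ab[unfolded abelian_J_def, rule_format, of "J X" Y] by (simp add: J_simps br_simps)
  then show "integrable_structure br J"
    using ab by (simp add: integrable_structure_def abelian_J_def J_simps)
qed

lemma ce_diff_three_form:
  "ce_diff b \<beta> [X, Y, Z, W] = - \<beta> [b X Y, Z, W] + \<beta> [b X Z, Y, W] - \<beta> [b Y Z, X, W]
    - \<beta> [b X W, Y, Z] + \<beta> [b Y W, X, Z] - \<beta> [b Z W, X, Y]"
  by (simp add: ce_diff_def nths_Cons numeral_eq_Suc)

text \<open>The form puts one \<open>J\<close> on the bracket and the pullback one on the remaining
  argument; these two cancel because \<open>J\<close> is an isometry, those inside the bracket
  because \<open>J\<close> is abelian.\<close>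

lemma pullback_diff_fundamental_form:
  assumes abelian_J
  shows "form_pullback J (ce_diff br (fundamental_form J)) [X, Y, Z]
    = - (br X Y \<bullet> Z) + br X Z \<bullet> Y - br Y Z \<bullet> X"
  using assms
  by (simp add: form_pullback_def ce_diff_two_form fundamental_form_def inner_J_J abelian_J_def)

text \<open>The terms with iterated brackets cancel in triples by the Jacobi identity.\<close>

lemma diff_pullback_diff_fundamental_form:
  assumes abelian_J
  shows "ce_diff br (form_pullback J (ce_diff br (fundamental_form J))) [X, Y, Z, W]
    = 2 * (br X Y \<bullet> br Z W - br X Z \<bullet> br Y W + br X W \<bullet> br Y Z)"
proof -
  have jac: "br (br a b) c \<bullet> d - br (br a c) b \<bullet> d + br (br b c) a \<bullet> d = 0" for a b c d
  proof -
    have "br (br a b) c - br (br a c) b + br (br b c) a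
        = - (br c (br a b) + br a (br b c) + br b (br c a))"
      using br_swap[of "br a b" c] br_swap[of "br a c" b] br_swap[of "br b c" a] br_swap[of a c]
      by (simp add: br_simps)
    also have "\<dots> = 0" using br_jacobi[of c a b] by simp
    finally show ?thesis by (metis inner_add_left inner_diff_left inner_zero_left)
  qed
  show ?thesis
    unfolding ce_diff_three_form pullback_diff_fundamental_form[OF assms]
    using jac[of X Y Z W] jac[of X Y W Z] jac[of X Z W Y] jac[of Y Z W X]
      inner_commute[of "br Z W" "br X Y"] inner_commute[of "br Y W" "br X Z"]
      inner_commute[of "br Y Z" "br X W"]
    by (simp add: algebra_simps)
qed

lemma SKT_iff:
  assumes "totally_real J V"
  shows "SKT br J \<longleftrightarrow> abelian_J \<and> cyclic_inner"
proof (cases abelian_J)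
  case True
  have "(\<forall>Xs. length Xs = 4 \<longrightarrow>
      ce_diff br (form_pullback J (ce_diff br (fundamental_form J))) Xs = 0) \<longleftrightarrow>
    (\<forall>X Y Z W. ce_diff br (form_pullback J (ce_diff br (fundamental_form J))) [X, Y, Z, W] = 0)"
    by (force simp: numeral_eq_Suc length_Suc_conv)
  also have "\<dots> \<longleftrightarrow> cyclic_inner"
    unfolding diff_pullback_diff_fundamental_form[OF True] cyclic_inner_def mult_eq_0_iff by simp
  finally show ?thesis
    using True integrable_iff_abelian_J[OF assms] by (simp add: SKT_def)
next
  case False
  then show ?thesis using integrable_iff_abelian_J[OF assms] by (simp add: SKT_def)
qed

end

section \<open>Orthonormal eigenbases\<close>

text \<open>The polynomial has a minimum at \<open>t = 0\<close>, so its derivative \<open>a\<close>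
  there vanishes.\<close>

lemma nonneg_perturbation_imp_zero:
  fixes a b :: real
  assumes "\<And>t. 0 \<le> t * a + t\<^sup>2 * b"
  shows "a = 0"
proof (rule ccontr)
  assume "a \<noteq> 0"
  \<comment> \<open>\<open>p\<close> is positive and exceeds \<open>b\<close> whatever the sign of
    \<open>b\<close>, so the value at \<open>- a / p\<close> is negative.\<close>
  define p where "p = 1 + \<bar>b\<bar>"
  define t where "t = - a / p"
  have p: "p > 0" "b < p" by (auto simp: p_def)
  then have "t * a + t\<^sup>2 * b = a\<^sup>2 * (b - p) / p\<^sup>2"
    by (simp add: t_def field_simps power2_eq_square)
  also have "\<dots> < 0"
    using \<open>a \<noteq> 0\<close> p by (intro divide_neg_pos mult_pos_neg) auto
  finally show False using assms[of t] by simp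
qed

text \<open>A maximiser \<open>w\<close> of \<open>T x \<bullet> x\<close> on the unit sphere of
  \<open>M\<close> works: the form \<open>c * (y \<bullet> y) - T y \<bullet> y\<close> is
  nonnegative on \<open>M\<close> and vanishes at \<open>w\<close>, so its first variation at
  \<open>w\<close> vanishes, and this variation is \<open>c w - T w\<close> paired with
  \<open>y\<close>.\<close>

lemma symmetric_eigenvector:
  fixes T :: "'a::euclidean_space \<Rightarrow> 'a"
  assumes M: "subspace M" "M \<noteq> {0}" and T: "linear T" "\<And>x. x \<in> M \<Longrightarrow> T x \<in> M"
    and sym: "\<And>x y. x \<in> M \<Longrightarrow> y \<in> M \<Longrightarrow> T x \<bullet> y = x \<bullet> T y"
  obtains w c where "w \<in> M" "norm w = 1" "T w = c *\<^sub>R w"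
proof -
  let ?S = "M \<inter> sphere 0 1"
  obtain x where x: "x \<in> M" "x \<noteq> 0" using M subspace_0 by blast
  then have "x /\<^sub>R norm x \<in> ?S" using M(1) by (simp add: subspace_scale)
  moreover have "compact ?S"
    by (intro closed_Int_compact closed_subspace M(1) compact_sphere)
  moreover have "continuous_on ?S (\<lambda>x. T x \<bullet> x)"
    using T(1) by (intro continuous_on_inner linear_continuous_on continuous_on_id)
      (simp add: linear_conv_bounded_linear)
  ultimately obtain w where w: "w \<in> ?S" and max: "\<And>y. y \<in> ?S \<Longrightarrow> T y \<bullet> y \<le> T w \<bullet> w"
    using continuous_attains_sup[of ?S "\<lambda>x. T x \<bullet> x"] by blast
  define c where "c = T w \<bullet> w"
  have wM: "w \<in> M" and nw: "norm w = 1" using w by auto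
  have psd: "0 \<le> c * (y \<bullet> y) - T y \<bullet> y" if y: "y \<in> M" for y
  proof (cases "y = 0")
    case False
    have "y /\<^sub>R norm y \<in> ?S" using y False M(1) by (simp add: subspace_scale)
    from max[OF this] have "(T y \<bullet> y) / (norm y)\<^sup>2 \<le> c"
      by (simp add: c_def linear_scale[OF T(1)] divide_inverse power2_eq_square mult_ac)
    then show ?thesis using False by (simp add: field_simps dot_square_norm)
  qed (simp add: linear_0[OF T(1)])
  have "(c *\<^sub>R w - T w) \<bullet> y = 0" if y: "y \<in> M" for y
  proof -
    have "0 \<le> t * (2 * ((c *\<^sub>R w - T w) \<bullet> y)) + t\<^sup>2 * (c * (y \<bullet> y) - T y \<bullet> y)" for t
    proof -
      have "w + t *\<^sub>R y \<in> M" using wM y M(1) by (simp add: subspace_add subspace_scale)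
      from psd[OF this] show ?thesis
        using sym[OF wM y] nw
        by (simp add: linear_add[OF T(1)] linear_scale[OF T(1)] inner_simps c_def
            power2_eq_square algebra_simps inner_commute norm_eq_1)
    qed
    from nonneg_perturbation_imp_zero[OF this] show ?thesis by simp
  qed
  moreover have "c *\<^sub>R w - T w \<in> M"
    using wM T(2) M(1) by (simp add: subspace_diff subspace_scale)
  ultimately have "T w = c *\<^sub>R w" by (metis eq_iff_diff_eq_0 inner_eq_zero_iff)
  then show ?thesis using that wM nw by blast
qed

lemma dim_less_subspace:
  fixes S M :: "'a::euclidean_space set"
  assumes "subspace S" "subspace M" "S \<subseteq> M" "S \<noteq> M"
  shows "dim S < dim M"
  using assms subspace_dim_equal[of S M] dim_subset[of S M] by linarith

text \<open>An eigenspace of a non-scalar member of \<open>F\<close> is invariant under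
  \<open>F\<close> by commutativity, its orthogonal complement in \<open>M\<close> by symmetry; both
  are smaller than \<open>M\<close>. Induction on the dimension of \<open>M\<close> allows
  \<open>F\<close> to be infinite.\<close>

lemma simultaneous_eigenbasis:
  fixes F :: "('a::euclidean_space \<Rightarrow> 'a) set"
  assumes "subspace M"
    and "\<And>T. T \<in> F \<Longrightarrow> linear T" and "\<And>T x. T \<in> F \<Longrightarrow> x \<in> M \<Longrightarrow> T x \<in> M"
    and "\<And>T x y. T \<in> F \<Longrightarrow> x \<in> M \<Longrightarrow> y \<in> M \<Longrightarrow> T x \<bullet> y = x \<bullet> T y"
    and "\<And>T T' x. T \<in> F \<Longrightarrow> T' \<in> F \<Longrightarrow> x \<in> M \<Longrightarrow> T (T' x) = T' (T x)"
  shows "\<exists>B. pairwise orthogonal B \<and> (\<forall>b\<in>B. norm b = 1) \<and> span B = M \<and>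
    (\<forall>b\<in>B. \<forall>T\<in>F. \<exists>c. T b = c *\<^sub>R b)"
  using assms(1,3-5)
proof (induction "dim M" arbitrary: M rule: less_induct)
  case less
  note lin = assms(2) and M = less.prems(1) and inv = less.prems(2) and sym = less.prems(3)
    and comm = less.prems(4)
  show ?case
  proof (cases "\<forall>T\<in>F. \<exists>c. \<forall>x\<in>M. T x = c *\<^sub>R x")
    case True
    obtain B where "B \<subseteq> M" "pairwise orthogonal B" "\<And>x. x \<in> B \<Longrightarrow> norm x = 1" "span B = M"
      using orthonormal_basis_subspace[OF M] by metis
    then show ?thesis using True by (intro exI[of _ B]) blast
  next
    case False
    then obtain T where T: "T \<in> F" and nonscalar: "\<And>c. \<exists>x\<in>M. T x \<noteq> c *\<^sub>R x" by blast
    have "M \<noteq> {0}" using nonscalar linear_0[OF lin[OF T]] by force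
    then obtain w c where w: "w \<in> M" "norm w = 1" "T w = c *\<^sub>R w"
      using symmetric_eigenvector[OF M _ lin[OF T] inv[OF T] sym[OF T]] by blast
    define M1 where "M1 = {x \<in> M. T x = c *\<^sub>R x}"
    define M2 where "M2 = {x \<in> M. \<forall>y\<in>M1. x \<bullet> y = 0}"
    have M1: "subspace M1"
      using M lin[OF T]
      by (auto simp: M1_def subspace_def linear_add linear_scale linear_0 scaleR_add_right)
    have M2: "subspace M2"
      using M by (auto simp: M2_def subspace_def inner_simps)
    have "M1 \<noteq> M" using nonscalar[of c] by (auto simp: M1_def)
    then have d1: "dim M1 < dim M" by (intro dim_less_subspace M1 M) (auto simp: M1_def)
    have "w \<in> M1" using w by (simp add: M1_def)
    then have "w \<notin> M2" using w(2) unfolding M2_def norm_eq_1 by force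
    then have "M2 \<noteq> M" using w(1) by blast
    then have d2: "dim M2 < dim M" by (intro dim_less_subspace M2 M) (auto simp: M2_def)
    have inv1: "T' x \<in> M1" if "T' \<in> F" "x \<in> M1" for T' x
      using that comm[OF T that(1), of x] inv lin[OF that(1)] by (auto simp: M1_def linear_scale)
    have inv2: "T' x \<in> M2" if "T' \<in> F" "x \<in> M2" for T' x
      using that sym[OF that(1)] inv1[OF that(1)] inv[OF that(1)] by (auto simp: M2_def M1_def)
    have sub: "M1 \<subseteq> M" "M2 \<subseteq> M" by (auto simp: M1_def M2_def)
    have sym1: "T' x \<bullet> y = x \<bullet> T' y" if "T' \<in> F" "x \<in> M1" "y \<in> M1" for T' x y
      using sym[OF that(1)] that(2,3) sub(1) by blast
    have sym2: "T' x \<bullet> y = x \<bullet> T' y" if "T' \<in> F" "x \<in> M2" "y \<in> M2" for T' x y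
      using sym[OF that(1)] that(2,3) sub(2) by blast
    have comm1: "T' (T'' x) = T'' (T' x)" if "T' \<in> F" "T'' \<in> F" "x \<in> M1" for T' T'' x
      using comm[OF that(1,2)] that(3) sub(1) by blast
    have comm2: "T' (T'' x) = T'' (T' x)" if "T' \<in> F" "T'' \<in> F" "x \<in> M2" for T' T'' x
      using comm[OF that(1,2)] that(3) sub(2) by blast
    obtain B1 where B1: "pairwise orthogonal B1" "\<forall>b\<in>B1. norm b = 1" "span B1 = M1"
      "\<forall>b\<in>B1. \<forall>T\<in>F. \<exists>c. T b = c *\<^sub>R b"
      using less.hyps[of M1, OF d1 M1] inv1 sym1 comm1 by blast
    obtain B2 where B2: "pairwise orthogonal B2" "\<forall>b\<in>B2. norm b = 1" "span B2 = M2"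
      "\<forall>b\<in>B2. \<forall>T\<in>F. \<exists>c. T b = c *\<^sub>R b"
      using less.hyps[of M2, OF d2 M2] inv2 sym2 comm2 by blast
    have sub12: "B1 \<subseteq> M1" "B2 \<subseteq> M2" using B1(3) B2(3) span_superset by blast+
    have "x \<bullet> y = 0" "y \<bullet> x = 0" if "x \<in> B1" "y \<in> B2" for x y
      using that sub12 by (auto simp: M2_def inner_commute[of x])
    then have "pairwise orthogonal (B1 \<union> B2)"
      using B1(1) B2(1)
      by (auto simp: pairwise_def orthogonal_def)
    moreover have "M \<subseteq> span (B1 \<union> B2)"
    proof
      fix x assume x: "x \<in> M"
      obtain y z where yz: "y \<in> span M1" "\<And>w. w \<in> span M1 \<Longrightarrow> orthogonal z w" "x = y + z"
        using orthogonal_subspace_decomp_exists[of M1 x] by blast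
      have y: "y \<in> M1" using yz(1) M1 by (metis span_eq_iff)
      then have "z \<in> M" using yz(3) x M sub by (metis add_diff_cancel_left' subsetD subspace_diff)
      then have "z \<in> M2" using yz(2) by (auto simp: M2_def orthogonal_def span_base)
      then show "x \<in> span (B1 \<union> B2)"
        using y yz(3) B1(3) B2(3) by (metis span_add span_mono subsetD sup_ge1 sup_ge2)
    qed
    moreover have "span (B1 \<union> B2) \<subseteq> M"
      using sub sub12 M by (meson Un_least span_minimal subset_trans)
    ultimately show ?thesis using B1(2,4) B2(2,4) by (intro exI[of _ "B1 \<union> B2"]) blast
  qed
qed

lemma orthonormal_basis_of_set:
  fixes B :: "'a::euclidean_space set"
  assumes "pairwise orthogonal B" "\<forall>b\<in>B. norm b = 1" "span B = M"
  obtains X where "orthonormal_basis (dim M) X M" "X ` {1..dim M} = B"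
proof -
  have "0 \<notin> B" using assms(2) by force
  then have ind: "independent B" using assms(1) pairwise_orthogonal_independent by blast
  then have card: "card B = dim M" using assms(3) dim_span_eq_card_independent by metis
  obtain X where X: "bij_betw X {1..dim M} B"
    using ex_bij_betw_nat_finite_1[OF independent_imp_finite[OF ind]] card by metis
  have "X i \<bullet> X j = (if i = j then 1 else 0)" if "i \<in> {1..dim M}" "j \<in> {1..dim M}" for i j
    using that X assms(1,2) bij_betwE[OF X] bij_betw_imp_inj_on[OF X]
    by (auto simp: pairwise_def orthogonal_def inj_on_eq_iff norm_eq_1[symmetric])
  moreover have "X ` {1..dim M} = B" using X by (simp add: bij_betw_def)
  ultimately show ?thesis
    using assms(3) by (intro that[of X]) (simp_all add: orthonormal_basis_def)
qed

lemma orthonormal_basis_exists: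
  fixes M :: "'a::euclidean_space set"
  assumes "subspace M"
  obtains X where "orthonormal_basis (dim M) X M"
proof -
  obtain B where "pairwise orthogonal B" "\<forall>b\<in>B. norm b = 1" "span B = M"
    using orthonormal_basis_subspace[OF assms] by metis
  then show ?thesis using orthonormal_basis_of_set that by blast
qed

context
  fixes m :: nat and X :: "nat \<Rightarrow> 'a::real_inner" and M :: "'a set"
  assumes onb: "orthonormal_basis m X M"
begin

lemma onb_inner: "i \<in> {1..m} \<Longrightarrow> j \<in> {1..m} \<Longrightarrow> X i \<bullet> X j = (if i = j then 1 else 0)"
  and onb_span: "span (X ` {1..m}) = M"
  using onb unfolding orthonormal_basis_def by blast+

lemma onb_in: "i \<in> {1..m} \<Longrightarrow> X i \<in> M"
  unfolding onb_span[symmetric] by (intro span_base imageI)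

lemma onb_inner_sum:
  assumes "i \<in> {1..m}"
  shows "X i \<bullet> (\<Sum>j\<in>{1..m}. c j *\<^sub>R X j) = c i"
proof -
  have "X i \<bullet> (\<Sum>j\<in>{1..m}. c j *\<^sub>R X j) = (\<Sum>j\<in>{1..m}. if j = i then c j else 0)"
    unfolding inner_sum_right by (intro sum.cong refl) (use assms in \<open>auto simp: onb_inner\<close>)
  then show ?thesis using assms by simp
qed

lemma onb_expand:
  assumes "v \<in> M"
  shows "v = (\<Sum>i\<in>{1..m}. (X i \<bullet> v) *\<^sub>R X i)"
proof -
  have "v \<in> span (X ` {1..m})" using assms onb_span by simp
  then show ?thesis
  proof (induction rule: span_induct_alt)
    case (step c x y)
    obtain j where j: "j \<in> {1..m}" "x = X j" using step(1) by auto
    have "(\<Sum>i\<in>{1..m}. (X i \<bullet> X j) *\<^sub>R X i) = (\<Sum>i\<in>{1..m}. if i = j then X j else 0)"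
      by (intro sum.cong refl) (use j in \<open>auto simp: onb_inner\<close>)
    then have "x = (\<Sum>i\<in>{1..m}. (X i \<bullet> x) *\<^sub>R X i)" using j by simp
    then have "c *\<^sub>R x + y
        = c *\<^sub>R (\<Sum>i\<in>{1..m}. (X i \<bullet> x) *\<^sub>R X i) + (\<Sum>i\<in>{1..m}. (X i \<bullet> y) *\<^sub>R X i)"
      using step(2) by simp
    also have "\<dots> = (\<Sum>i\<in>{1..m}. (X i \<bullet> (c *\<^sub>R x + y)) *\<^sub>R X i)"
      by (simp add: inner_add_right scaleR_add_left sum.distrib scaleR_sum_right)
    finally show ?case .
  qed simp
qed

lemma onb_eqI:
  assumes "v \<in> M" "w \<in> M" "\<And>i. i \<in> {1..m} \<Longrightarrow> X i \<bullet> v = X i \<bullet> w"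
  shows "v = w"
proof -
  have "(\<Sum>i\<in>{1..m}. (X i \<bullet> v) *\<^sub>R X i) = (\<Sum>i\<in>{1..m}. (X i \<bullet> w) *\<^sub>R X i)"
    using assms(3) by simp
  then show ?thesis
    unfolding onb_expand[OF assms(1), symmetric] onb_expand[OF assms(2), symmetric] .
qed

lemma onb_inner_expand:
  assumes "v \<in> M"
  shows "v \<bullet> w = (\<Sum>i\<in>{1..m}. (X i \<bullet> v) * (X i \<bullet> w))"
proof -
  have "v \<bullet> w = (\<Sum>i\<in>{1..m}. (X i \<bullet> v) *\<^sub>R X i) \<bullet> w"
    by (rule arg_cong[where f = "\<lambda>u. u \<bullet> w", OF onb_expand[OF assms]])
  then show ?thesis by (simp add: inner_sum_left)
qed

end

section \<open>The product \<open>[J A, B]\<close> on the commutator ideal\<close>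

locale abelian_cyclic = almost_hermitian_lie_algebra +
  assumes two_step: "two_step_solvable br"
    and abelian_J: abelian_J
    and cyclic_inner: cyclic_inner
begin

abbreviation W :: "'a set" where "W \<equiv> bracket_span br V (J ` V)"

lemma br_V_V: "x \<in> V \<Longrightarrow> y \<in> V \<Longrightarrow> br x y = 0"
  using two_step by (simp add: two_step_solvable_def)

lemma br_J_J: "br (J x) (J y) = br x y"
  using abelian_J by (simp add: abelian_J_def)

lemma br_J_right: "br x (J y) = - br (J x) y"
proof -
  have "- br x (J y) = br (J x) y" using br_J_J[of "J x" y] by (simp add: J_simps br_simps)
  then show ?thesis by (metis minus_minus)
qed

lemma cyclic: "br x y \<bullet> br z w - br x z \<bullet> br y w + br x w \<bullet> br y z = 0"
  using cyclic_inner by (simp add: cyclic_inner_def)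

text \<open>The prefix \<open>star\<close> refers to the product \<open>a * b = [J a, b]\<close>. Its multiplications are adjoint maps,
  so the lemma \<open>ad_commute\<close> contains associativity.\<close>

lemma star_commute: "br (J a) b = br (J b) a"
  using br_J_right[of b a] br_swap[of "J a" b] by simp

text \<open>The commutator of two adjoint maps is the adjoint map of an element of \<open>V\<close>,
  which kills the Abelian ideal \<open>V\<close>.\<close>

lemma ad_commute:
  assumes "a \<in> V"
  shows "br x (br y a) = br y (br x a)"
  using br_jacobi[of x y a] br_swap[of a x] br_V_V[OF assms br_in_V, of x y]
  by (simp add: br_simps)

text \<open>The Jacobi identity with \<open>J\<close> moved across the brackets. It evaluates
  multiplication by \<open>a\<close> on brackets, hence on all of \<open>V\<close>, which they
  span.\<close>

lemma star_bracket:
  assumes "a \<in> V"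
  shows "br (J a) (br y z) = br y (br (J z) a) - br z (br (J y) a)"
  using br_jacobi[of "J a" y z] br_J_right[of z a] br_swap[of "J a" y] br_J_right[of y a]
  by (simp add: br_simps algebra_simps)

text \<open>In the SKT identity at \<open>(J a, b, J c, d)\<close> the middle term contains
  \<open>[b, d] = 0\<close>. Combined with commutativity this permits every permutation of the four
  arguments.\<close>

lemma star_inner_swap:
  assumes "b \<in> V" "d \<in> V"
  shows "br (J a) b \<bullet> br (J c) d = br (J a) d \<bullet> br (J c) b"
  using cyclic[of "J a" b "J c" d] br_V_V[OF assms] br_swap[of b "J c"]
  by simp

lemma star_null_central:
  assumes "br (J a) a = 0"
  shows "br y a = 0" "br (J a) y = 0"
proof -
  \<comment> \<open>The first term of the identity vanishes by assumption; moving \<open>J\<close>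
    turns the other two into squared norms.\<close>
  have "br a y \<bullet> br a y + br a (J y) \<bullet> br a (J y) = 0" for y
    using cyclic[of "J a" a y "J y"] assms br_J_right[of a y] br_J_J[of a y]
    by (simp add: inner_commute)
  then have "br a y \<bullet> br a y = 0" for y
    by (metis add_nonneg_eq_0_iff inner_ge_zero)
  then have "br a y = 0" for y by simp
  then show "br y a = 0" "br (J a) y = 0"
    using br_swap[of y a] br_J_right[of a y] by simp_all
qed

lemma subspace_W: "subspace W"
  by (simp add: bracket_span_def)

lemma star_in_W: "a \<in> V \<Longrightarrow> b \<in> V \<Longrightarrow> br (J a) b \<in> W"
  unfolding star_commute[of a b] bracket_span_def
  by (rule span_neg[where x = "- br (J b) a", simplified], rule span_base)
    (auto simp: br_swap[of "J b" a])

lemma W_induct [consumes 1, case_names star zero add scale]: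
  assumes "v \<in> W" "\<And>x y. x \<in> V \<Longrightarrow> y \<in> V \<Longrightarrow> P (br (J x) y)" "P 0"
    "\<And>x y. P x \<Longrightarrow> P y \<Longrightarrow> P (x + y)" "\<And>c x. P x \<Longrightarrow> P (c *\<^sub>R x)"
  shows "P v"
proof -
  have "v \<in> span {br x y | x y. x \<in> V \<and> y \<in> J ` V}"
    using assms(1) by (simp add: bracket_span_def)
  then show ?thesis
  proof (induction rule: span_induct_alt)
    case (step c x y)
    then obtain a b where "a \<in> V" "b \<in> V" "x = br a (J b)" by auto
    then have "x = (-1) *\<^sub>R br (J a) b" by (simp add: br_J_right)
    then show ?case using step \<open>a \<in> V\<close> \<open>b \<in> V\<close> assms by metis
  qed (rule assms(3))
qed

lemma W_subset_V: "W \<subseteq> V"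
  unfolding bracket_span_def[of br V] by (rule span_minimal) (auto simp: subspace_V)

text \<open>The form \<open>\<langle>a * b, c * d\<rangle>\<close> is totally symmetric, hence so is \<open>\<langle>a * (c * d), e * f\<rangle>\<close> in
  \<open>c, d, e, f\<close>.\<close>

lemma star_symmetric_aux:
  assumes V: "a \<in> V" "c \<in> V" "d \<in> V" "e \<in> V" "f \<in> V"
  shows "br (J a) (br (J c) d) \<bullet> br (J e) f = br (J c) d \<bullet> br (J a) (br (J e) f)"
proof -
  have "br (J a) (br (J c) d) \<bullet> br (J e) f = br (J a) f \<bullet> br (J e) (br (J c) d)"
    using V by (simp add: star_inner_swap)
  also have "br (J e) (br (J c) d) = br (J c) (br (J e) d)"
    using V by (simp add: ad_commute)
  also have "br (J a) f \<bullet> br (J c) (br (J e) d) = br (J a) (br (J e) d) \<bullet> br (J c) f"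
    using V by (simp add: star_inner_swap)
  also have "br (J a) (br (J e) d) = br (J d) (br (J a) e)"
    using V by (metis ad_commute star_commute)
  also have "\<dots> \<bullet> br (J c) f = br (J d) f \<bullet> br (J c) (br (J a) e)"
    using V by (simp add: star_inner_swap)
  also have "\<dots> = br (J c) (br (J a) e) \<bullet> br (J f) d"
    by (simp add: inner_commute star_commute[of d f])
  also have "\<dots> = br (J c) d \<bullet> br (J f) (br (J a) e)"
    using V by (simp add: star_inner_swap)
  also have "br (J f) (br (J a) e) = br (J a) (br (J e) f)"
    using V by (metis ad_commute star_commute)
  finally show ?thesis .
qed

text \<open>The total symmetry concerns products, and these span \<open>W\<close>; this is why both
  arguments range over \<open>W\<close> while the multiplier ranges over \<open>V\<close>.\<close>

lemma star_symmetric: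
  assumes "a \<in> V" "x \<in> W" "y \<in> W"
  shows "br (J a) x \<bullet> y = x \<bullet> br (J a) y"
  using assms(2)
proof (induction rule: W_induct)
  case (star c d)
  from assms(3) show ?case
    by (induction rule: W_induct)
      (use star assms(1) in \<open>auto simp: star_symmetric_aux inner_simps br_simps\<close>)
qed (simp_all add: inner_simps br_simps)

lemma star_eigenbasis:
  obtains w where "orthonormal_basis (dim W) w W"
    and "\<And>i a. i \<in> {1..dim W} \<Longrightarrow> a \<in> V \<Longrightarrow> \<exists>c. br (J a) (w i) = c *\<^sub>R w i"
proof -
  let ?F = "(\<lambda>a. br (J a)) ` V"
  have "\<exists>B. pairwise orthogonal B \<and> (\<forall>b\<in>B. norm b = 1) \<and> span B = W \<and>
    (\<forall>b\<in>B. \<forall>T\<in>?F. \<exists>c. T b = c *\<^sub>R b)"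
  proof (rule simultaneous_eigenbasis[OF subspace_W])
    show "T x \<in> W" if "T \<in> ?F" "x \<in> W" for T x
      using that W_subset_V star_in_W by auto
    show "T (T' x) = T' (T x)" if "T \<in> ?F" "T' \<in> ?F" "x \<in> W" for T T' x
      using that W_subset_V ad_commute by blast
  qed (auto simp: linear_br_right star_symmetric)
  then obtain B where B: "pairwise orthogonal B" "\<forall>b\<in>B. norm b = 1" "span B = W"
    "\<forall>b\<in>B. \<forall>T\<in>?F. \<exists>c. T b = c *\<^sub>R b" by blast
  obtain w where w: "orthonormal_basis (dim W) w W" "w ` {1..dim W} = B"
    using orthonormal_basis_of_set[OF B(1-3)] by blast
  have "\<exists>c. br (J a) (w i) = c *\<^sub>R w i" if "i \<in> {1..dim W}" "a \<in> V" for i a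
    using that w(2) B(4) by blast
  then show ?thesis using that w(1) by blast
qed

text \<open>The eigenvalue of \<open>br x\<close> at a unit eigenvector \<open>v\<close>. As an
  inner product it is linear in \<open>x\<close> before \<open>v\<close> is known to be an
  eigenvector of every \<open>br x\<close>.\<close>

definition ad_coeff :: "'a \<Rightarrow> 'a \<Rightarrow> real"
  where "ad_coeff v x = v \<bullet> br x v"

lemma ad_coeff_add: "ad_coeff v (x + y) = ad_coeff v x + ad_coeff v y"
  and ad_coeff_scaleR: "ad_coeff v (c *\<^sub>R x) = c * ad_coeff v x"
  and ad_coeff_zero: "ad_coeff v 0 = 0"
  by (simp_all add: ad_coeff_def br_simps inner_simps)

lemma ad_coeff_eqI:
  assumes "br x v = c *\<^sub>R v" "v \<bullet> v = 1"
  shows "ad_coeff v x = c"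
  using assms by (simp add: ad_coeff_def)

text \<open>The orthogonal complement in \<open>V\<close> of those \<open>w i\<close> that are
  multiples of idempotents. It may reach outside \<open>W\<close>, and until
  \<open>lam_nonzero\<close> it may also contain some \<open>w i\<close>.\<close>

definition star_null_part :: "nat \<Rightarrow> (nat \<Rightarrow> 'a) \<Rightarrow> 'a set"
  where "star_null_part k w =
    {a \<in> V. \<forall>i\<in>{1..k}. ad_coeff (w i) (J (w i)) \<noteq> 0 \<longrightarrow> w i \<bullet> a = 0}"

section \<open>Characters and central elements of the product, from a common eigenbasis of
  \<open>W\<close>\<close>

context
  fixes k :: nat and w :: "nat \<Rightarrow> 'a"
  assumes w: "orthonormal_basis k w W"
    and eig: "\<And>i a. i \<in> {1..k} \<Longrightarrow> a \<in> V \<Longrightarrow> \<exists>c. br (J a) (w i) = c *\<^sub>R w i"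
begin

abbreviation nu :: "nat \<Rightarrow> 'a \<Rightarrow> real" where "nu i \<equiv> ad_coeff (w i)"

abbreviation lam :: "nat \<Rightarrow> real" where "lam i \<equiv> nu i (J (w i))"

lemma w_inner: "i \<in> {1..k} \<Longrightarrow> j \<in> {1..k} \<Longrightarrow> w i \<bullet> w j = (if i = j then 1 else 0)"
  using onb_inner[OF w] by blast

lemma w_in_W: "i \<in> {1..k} \<Longrightarrow> w i \<in> W"
  using onb_in[OF w] by blast

lemma w_in_V: "i \<in> {1..k} \<Longrightarrow> w i \<in> V"
  using w_in_W W_subset_V by blast

lemma w_nonzero: "i \<in> {1..k} \<Longrightarrow> w i \<noteq> 0"
  using w_inner[of i i] by auto

lemma star_w_eq:
  assumes "i \<in> {1..k}" "a \<in> V"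
  shows "br (J a) (w i) = nu i (J a) *\<^sub>R w i"
proof -
  obtain c where "br (J a) (w i) = c *\<^sub>R w i" using eig[OF assms] by blast
  then show ?thesis using ad_coeff_eqI[of "J a" "w i" c] w_inner[of i i] assms(1) by simp
qed

text \<open>By commutativity the product is a multiple of both \<open>w i\<close> and
  \<open>w j\<close>.\<close>

lemma star_w_w:
  assumes "i \<in> {1..k}" "j \<in> {1..k}" "i \<noteq> j"
  shows "br (J (w i)) (w j) = 0"
proof -
  have "nu j (J (w i)) *\<^sub>R w j = nu i (J (w j)) *\<^sub>R w i"
    using star_w_eq[OF assms(2) w_in_V[OF assms(1)]] star_w_eq[OF assms(1) w_in_V[OF assms(2)]]
      star_commute[of "w i" "w j"] by simp
  then have "nu j (J (w i)) * (w j \<bullet> w j) = nu i (J (w j)) * (w j \<bullet> w i)"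
    by (metis inner_scaleR_right)
  then have "nu j (J (w i)) = 0" using assms by (simp add: w_inner)
  then show ?thesis using star_w_eq[OF assms(2) w_in_V[OF assms(1)]] by simp
qed

text \<open>Each \<open>a \<mapsto> nu i (J a)\<close> is a character of the algebra: by
  associativity, multiplying by a product composes the multiplications.\<close>

lemma nu_star:
  assumes "i \<in> {1..k}" "a \<in> V" "b \<in> V"
  shows "nu i (J (br (J a) b)) = nu i (J a) * nu i (J b)"
proof -
  have "br (J (br (J a) b)) (w i) = br (J a) (br (J b) (w i))"
    using assms w_in_V by (metis ad_commute star_commute)
  also have "\<dots> = (nu i (J a) * nu i (J b)) *\<^sub>R w i"
    using assms by (simp add: star_w_eq br_simps mult.commute)
  finally show ?thesis using ad_coeff_eqI w_inner[of i i] assms(1) by simp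
qed

lemma nu_W:
  assumes "i \<in> {1..k}" "v \<in> W"
  shows "nu i (J v) = lam i * (w i \<bullet> v)"
proof -
  have "br (J (w i)) v = (\<Sum>j\<in>{1..k}. (w j \<bullet> v) *\<^sub>R br (J (w i)) (w j))"
    by (subst onb_expand[OF w assms(2)])
      (simp add: linear_sum[OF linear_br_right] linear_scale[OF linear_br_right])
  also have "\<dots> = (\<Sum>j\<in>{1..k}. if j = i then (w i \<bullet> v) *\<^sub>R br (J (w i)) (w i) else 0)"
    by (intro sum.cong refl) (use assms in \<open>auto simp: star_w_w\<close>)
  also have "\<dots> = (w i \<bullet> v) *\<^sub>R br (J (w i)) (w i)"
    using assms(1) by simp
  also have "\<dots> = (lam i * (w i \<bullet> v)) *\<^sub>R w i"
    using star_w_eq[OF assms(1) w_in_V[OF assms(1)]] by (simp add: mult.commute)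
  finally show ?thesis using ad_coeff_eqI[of "J v" "w i"] w_inner[of i i] assms(1)
    by (simp add: star_commute[of v])
qed

text \<open>For \<open>a\<close> outside \<open>W\<close> one passes to \<open>a * a\<close>, which
  lies in \<open>W\<close>: the character there is the square of its value at \<open>a\<close>, and
  \<open>nu_W\<close> makes it a multiple of \<open>lam i\<close>.\<close>

lemma nu_zero:
  assumes "i \<in> {1..k}" "lam i = 0" "a \<in> V"
  shows "nu i (J a) = 0"
proof -
  have "nu i (J a) * nu i (J a) = 0"
    using nu_star[OF assms(1,3,3)] nu_W[OF assms(1) star_in_W[OF assms(3,3)]] assms(2) by simp
  then show ?thesis by simp
qed

text \<open>Up to the factor \<open>lam i\<close>, \<open>w i\<close> is its own square, so
  \<open>[y, w i]\<close> is a multiple of the product of \<open>[y, w i]\<close> with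
  \<open>w i\<close>; that product lies on the line of \<open>w i\<close>. Thus the eigenvector
  property passes from \<open>J a\<close> with \<open>a \<in> V\<close> to arbitrary
  \<open>y\<close>.\<close>

lemma ad_w:
  assumes "i \<in> {1..k}" "lam i \<noteq> 0"
  shows "br y (w i) = nu i y *\<^sub>R w i"
proof -
  have "lam i *\<^sub>R br y (w i) = br y (br (J (w i)) (w i))"
    using arg_cong[OF star_w_eq[OF assms(1) w_in_V[OF assms(1)]], of "br y"]
    by (simp only: br_scaleR_right)
  also have "\<dots> = br (J (br y (w i))) (w i)"
    using assms w_in_V by (metis ad_commute star_commute)
  also have "\<dots> = nu i (J (br y (w i))) *\<^sub>R w i"
    using star_w_eq[OF assms(1) br_in_V] by simp
  finally have "(1 / lam i) *\<^sub>R lam i *\<^sub>R br y (w i)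
      = (1 / lam i) *\<^sub>R nu i (J (br y (w i))) *\<^sub>R w i"
    by simp
  then have "br y (w i) = (nu i (J (br y (w i))) / lam i) *\<^sub>R w i"
    using assms(2) by simp
  then show ?thesis using ad_coeff_eqI w_inner[of i i] assms(1) by fastforce
qed

text \<open>The SKT identity at \<open>(J (w i), w i, y, z)\<close>, where every bracket with
  \<open>w i\<close> or \<open>J (w i)\<close> is a multiple of \<open>w i\<close>.\<close>

lemma inner_w_bracket:
  assumes "i \<in> {1..k}" "lam i \<noteq> 0"
  shows "lam i * (w i \<bullet> br y z) = nu i y * nu i (J z) - nu i z * nu i (J y)"
proof -
  note ad = ad_w[OF assms]
  have "br (J (w i)) x = nu i (J x) *\<^sub>R w i" for x
    using star_commute[of "w i" x] ad[of "J x"] by simp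
  moreover have "br (w i) x = - nu i x *\<^sub>R w i" for x
    using br_swap[of "w i" x] ad[of x] by simp
  ultimately show ?thesis
    using cyclic[of "J (w i)" "w i" y z] w_inner[of i i] assms(1) by (simp add: algebra_simps)
qed

text \<open>On a bracket \<open>[y, z]\<close>, \<open>star_bracket\<close> computes the left side
  and \<open>inner_w_bracket\<close> the right side, with the same result.\<close>

lemma nu_V:
  assumes "i \<in> {1..k}" "lam i \<noteq> 0" "a \<in> V"
  shows "nu i (J a) = lam i * (w i \<bullet> a)"
  using assms(3)
proof (induction rule: V_induct)
  case (base y z)
  have "br (J (br y z)) (w i) = br (J (w i)) (br y z)" by (rule star_commute)
  also have "\<dots> = (nu i y * nu i (J z) - nu i z * nu i (J y)) *\<^sub>R w i"
    unfolding star_bracket[OF w_in_V[OF assms(1)]]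
    by (simp add: ad_w[OF assms(1,2)] br_simps algebra_simps)
  finally show ?case
    using inner_w_bracket[OF assms(1,2), of y z] ad_coeff_eqI w_inner[of i i] assms(1) by simp
qed (simp_all add: J_simps ad_coeff_add ad_coeff_scaleR ad_coeff_zero inner_simps algebra_simps)

abbreviation null_part :: "'a set" where "null_part \<equiv> star_null_part k w"

lemmas null_part_def = star_null_part_def[of k w]

lemma star_w_null_part:
  assumes "a \<in> null_part" "i \<in> {1..k}" "lam i \<noteq> 0"
  shows "br (J (w i)) a = 0"
  using assms nu_V[OF assms(2,3), of a] star_w_eq[OF assms(2), of a]
  by (simp add: null_part_def star_commute[of "w i"])

text \<open>All characters vanish on the product \<open>?n\<close>. As \<open>?n\<close> lies in
  \<open>W\<close>, expanding it in the eigenbasis gives \<open>?n * ?n = 0\<close>.\<close>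

lemma star_null_part_central:
  assumes "a \<in> null_part" "b \<in> null_part"
  shows "br y (br (J a) b) = 0"
proof -
  let ?n = "br (J a) b"
  have V: "a \<in> V" "b \<in> V" using assms by (auto simp: null_part_def)
  have "nu i (J ?n) = 0" if i: "i \<in> {1..k}" for i
  proof (cases "lam i = 0")
    case False
    then have "nu i (J a) = 0" using nu_V[OF i False] assms(1) V i by (simp add: null_part_def)
    then show ?thesis using nu_star[OF i V] by simp
  qed (use nu_zero[OF i] in simp)
  then have "br (J ?n) (w i) = 0" if "i \<in> {1..k}" for i
    using star_w_eq[OF that, of ?n] that by simp
  moreover have "br (J ?n) ?n = (\<Sum>j\<in>{1..k}. (w j \<bullet> ?n) *\<^sub>R br (J ?n) (w j))"
    by (subst (2) onb_expand[OF w star_in_W[OF V]])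
      (simp add: linear_sum[OF linear_br_right] linear_scale[OF linear_br_right])
  ultimately have "br (J ?n) ?n = 0" by simp
  then show ?thesis by (rule star_null_central)
qed

text \<open>The product of \<open>[x, b]\<close> with \<open>w i\<close> is
  \<open>[x, b * w i] = 0\<close>, and by \<open>nu_V\<close> its eigenvalue is \<open>lam i\<close>
  times the \<open>w i\<close> component of \<open>[x, b]\<close>.\<close>

lemma ad_null_part:
  assumes "b \<in> null_part"
  shows "br x b \<in> null_part"
proof -
  have "w i \<bullet> br x b = 0" if i: "i \<in> {1..k}" "lam i \<noteq> 0" for i
  proof -
    have "br (J (br x b)) (w i) = br x (br (J (w i)) b)"
      using assms by (metis (no_types, lifting) ad_commute mem_Collect_eq null_part_def star_commute)
    also have "\<dots> = 0" using star_w_null_part[OF assms i] by (simp add: br_simps)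
    finally show ?thesis using nu_V[OF i br_in_V[of x b]] i(2) by (simp add: ad_coeff_def)
  qed
  then show ?thesis by (simp add: null_part_def)
qed

text \<open>Being possibly outside \<open>W\<close>, \<open>a\<close> cannot be expanded in
  eigenvectors. Instead \<open>[x, a]\<close> has square zero, since its square is
  \<open>[x, [x, a] * a]\<close> with a central product inside; so \<open>[x, a]\<close> is central.
  By \<open>star_bracket\<close>, \<open>a\<close> then annihilates all brackets, hence
  \<open>V\<close>, and in particular \<open>a * a = 0\<close>.\<close>

lemma null_part_central:
  assumes a: "a \<in> null_part"
  shows "br y a = 0" "br (J a) y = 0"
proof -
  have aV: "a \<in> V" using a by (simp add: null_part_def)
  have "br y (br x a) = 0" for x y
  proof -
    have "br (J (br x a)) (br x a) = br x (br (J (br x a)) a)"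
      using aV by (rule ad_commute)
    also have "\<dots> = 0" using star_null_part_central[OF ad_null_part[OF a] a] .
    finally show ?thesis by (rule star_null_central)
  qed
  then have star: "br (J a) (br y z) = 0" for y z
    using star_bracket[OF aV] by simp
  have "br (J a) v = 0" if "v \<in> V" for v
    using that by (induction rule: V_induct) (simp_all add: br_simps star)
  from star_null_central[OF this[OF aV]]
  show "br y a = 0" "br (J a) y = 0" .
qed

text \<open>If \<open>\<lambda>\<^sub>i = 0\<close>, then \<open>w\<^sub>i\<close> is orthogonal to \<open>W\<close>, since only the idempotent directions contribute
  to products.\<close>

lemma lam_nonzero:
  assumes i: "i \<in> {1..k}"
  shows "lam i \<noteq> 0"
proof
  assume zero: "lam i = 0"
  have "w i \<bullet> v = 0" if "v \<in> W" for v
    using that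
  proof (induction rule: W_induct)
    case (star a b)
    let ?G = "{j \<in> {1..k}. lam j \<noteq> 0}"
    let ?p = "\<Sum>j\<in>?G. (w j \<bullet> a) *\<^sub>R w j"
    have "w j \<bullet> ?p = w j \<bullet> a" if "j \<in> ?G" for j
    proof -
      have "w j \<bullet> ?p = (\<Sum>l\<in>?G. if l = j then w j \<bullet> a else 0)"
        unfolding inner_sum_right by (intro sum.cong refl) (use that in \<open>auto simp: w_inner\<close>)
      then show ?thesis using that by simp
    qed
    moreover have "?p \<in> V"
      by (intro subspace_sum subspace_V subspace_scale) (use w_in_V in auto)
    ultimately have "a - ?p \<in> null_part"
      using star(1) by (auto simp: null_part_def inner_simps subspace_diff subspace_V)
    then have "br (J (a - ?p)) b = 0" by (rule null_part_central)
    then have "br (J a) b = br (J ?p) b" by (simp add: J_simps br_simps)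
    also have "\<dots> = br (J b) ?p" by (rule star_commute)
    also have "\<dots> = (\<Sum>j\<in>?G. (w j \<bullet> a) *\<^sub>R nu j (J b) *\<^sub>R w j)"
      using star(2)
      by (simp add: linear_sum[OF linear_br_right] linear_scale[OF linear_br_right] star_w_eq)
    finally show ?case
      using i zero by (auto simp: inner_sum_right w_inner intro!: sum.neutral)
  qed (simp_all add: inner_simps)
  from this[OF w_in_W[OF i]] show False using w_nonzero[OF i] by simp
qed

end

theorem eigenbasis_structure:
  obtains w where "orthonormal_basis (dim W) w W"
    and "\<And>i. i \<in> {1..dim W} \<Longrightarrow> ad_coeff (w i) (J (w i)) \<noteq> 0"
    and "\<And>i y. i \<in> {1..dim W} \<Longrightarrow> br y (w i) = ad_coeff (w i) y *\<^sub>R w i"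
    and "\<And>i y z. i \<in> {1..dim W} \<Longrightarrow> 
      ad_coeff (w i) (J (w i)) * (w i \<bullet> br y z) =
        ad_coeff (w i) y * ad_coeff (w i) (J z) - ad_coeff (w i) z * ad_coeff (w i) (J y)"
    and "\<And>i j. i \<in> {1..dim W} \<Longrightarrow> j \<in> {1..dim W} \<Longrightarrow> i \<noteq> j \<Longrightarrow> br (J (w i)) (w j) = 0"
    and "\<And>a y. a \<in> V \<Longrightarrow> (\<And>x. x \<in> W \<Longrightarrow> x \<bullet> a = 0) \<Longrightarrow> br y a = 0"
proof -
  obtain w where w: "orthonormal_basis (dim W) w W"
    "\<And>i a. i \<in> {1..dim W} \<Longrightarrow> a \<in> V \<Longrightarrow> \<exists>c. br (J a) (w i) = c *\<^sub>R w i"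
    using star_eigenbasis by blast
  have "br y a = 0" if "a \<in> V" "\<And>x. x \<in> W \<Longrightarrow> x \<bullet> a = 0" for a y
    by (rule null_part_central(1)[OF w]) (use that w_in_W[OF w] in \<open>auto simp: star_null_part_def\<close>)
  then show ?thesis
    using lam_nonzero[OF w] ad_w[OF w] inner_w_bracket[OF w] star_w_w[OF w] that[OF w(1)] by blast
qed

end

section \<open>Existence of the normal form\<close>

text \<open>The rows \<open>(c, s)\<close> and \<open>(- s, c)\<close> are the sides of the
  quadrant. Slopes replace angles: \<open>?d\<close> and \<open>?e\<close> measure along and across
  a fixed nonzero vector of \<open>S\<close>, which itself serves as a side unless \<open>S\<close>
  has vectors on both sides of it or only below.\<close>

lemma acute_imp_quadrant:
  fixes S :: "(real \<times> real) set"
  assumes acute: "\<And>x y x' y'. (x, y) \<in> S \<Longrightarrow> (x', y') \<in> S \<Longrightarrow> 0 \<le> x * x' + y * y'"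
  obtains c s where "c\<^sup>2 + s\<^sup>2 = 1"
    and "\<And>x y. (x, y) \<in> S \<Longrightarrow> 0 \<le> c * x + s * y \<and> 0 \<le> c * y - s * x"
proof -
  note quadrant = that
  have normalize: ?thesis
    if r: "(r, t) \<noteq> (0, 0)" "\<And>x y. (x, y) \<in> S \<Longrightarrow> 0 \<le> r * x + t * y \<and> 0 \<le> r * y - t * x"
    for r t
  proof (rule quadrant)
    let ?n = "sqrt (r\<^sup>2 + t\<^sup>2)"
    have n: "r\<^sup>2 + t\<^sup>2 > 0" using r(1) by (auto simp: sum_power2_gt_zero_iff)
    then have "(r / ?n)\<^sup>2 + (t / ?n)\<^sup>2 = (r\<^sup>2 + t\<^sup>2) / (r\<^sup>2 + t\<^sup>2)"
      unfolding power_divide add_divide_distrib by simp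
    then show "(r / ?n)\<^sup>2 + (t / ?n)\<^sup>2 = 1" using n by (metis divide_self less_irrefl)
    fix x y assume "(x, y) \<in> S"
    from r(2)[OF this] have "0 \<le> (r * x + t * y) / ?n" "0 \<le> (r * y - t * x) / ?n"
      by simp_all
    then show "0 \<le> r / ?n * x + t / ?n * y \<and> 0 \<le> r / ?n * y - t / ?n * x"
      by (simp add: add_divide_distrib diff_divide_distrib)
  qed
  show ?thesis
  proof (cases "S \<subseteq> {(0, 0)}")
    case True
    then show ?thesis by (intro normalize[of 1 0]) auto
  next
    case False
    then obtain a b where ab: "(a, b) \<in> S" "(a, b) \<noteq> (0, 0)" by auto
    then have n: "a * a + b * b > 0"
      by (metis not_sum_squares_lt_zero not_less_iff_gr_or_eq prod.inject sum_squares_eq_zero_iff)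
    let ?d = "\<lambda>x y. a * x + b * y" and ?e = "\<lambda>x y. a * y - b * x"
    have d: "0 \<le> ?d x y" if "(x, y) \<in> S" for x y using acute[OF ab(1) that] .
    show ?thesis
    proof (cases "\<forall>(x, y)\<in>S. 0 \<le> ?e x y")
      case True
      then show ?thesis using ab d by (intro normalize[of a b]) auto
    next
      case False
      then obtain x1 y1 where xy1: "(x1, y1) \<in> S" "?e x1 y1 < 0" by auto
      have dd: "0 \<le> ?d x y * ?d x' y' + ?e x y * ?e x' y'"
        if "(x, y) \<in> S" "(x', y') \<in> S" for x y x' y'
      proof -
        have "?d x y * ?d x' y' + ?e x y * ?e x' y' = (a * a + b * b) * (x * x' + y * y')"
          by (simp add: algebra_simps)
        then show ?thesis using acute[OF that] n by simp
      qed
      \<comment> \<open>\<open>M\<close> is the largest slope \<open>?e / ?d\<close> occurring in \<open>S\<close>; the vector of that slope spans one side of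
        the quadrant.\<close>
      define D where "D = {m. 0 \<le> m \<and> (\<forall>(x, y)\<in>S. ?e x y \<le> m * ?d x y)}"
      \<comment> \<open>The pair \<open>(?d, ?e)\<close> is a uniformly scaled orthonormal
        coordinate system, so vectors of \<open>S\<close> stay pairwise acute in it. The
        perpendicular to a vector with negative \<open>?e\<close> therefore bounds all
        slopes.\<close>
      have slope: "?d x y / (- ?e x y) \<in> D" if "(x, y) \<in> S" "?e x y < 0" for x y
      proof -
        have "?e x' y' \<le> ?d x y / (- ?e x y) * ?d x' y'" if "(x', y') \<in> S" for x' y'
        proof -
          have "?e x' y' * (- ?e x y) \<le> ?d x y * ?d x' y'"
            using dd[OF \<open>(x, y) \<in> S\<close> that] by (simp add: algebra_simps)
          then have "?e x' y' \<le> (?d x y * ?d x' y') / (- ?e x y)"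
            using \<open>?e x y < 0\<close> by (subst pos_le_divide_eq) auto
          then show ?thesis by simp
        qed
        moreover have "0 \<le> ?d x y / (- ?e x y)"
          using d[OF that(1)] that(2) by (intro divide_nonneg_nonneg) auto
        ultimately show ?thesis unfolding D_def by auto
      qed
      define M where "M = Inf D"
      have ne: "D \<noteq> {}" using slope[OF xy1] by blast
      have bdd: "bdd_below D" by (rule bdd_belowI[of _ 0]) (auto simp: D_def)
      have M1: "?e x y \<le> M * ?d x y" if xy: "(x, y) \<in> S" for x y
      proof (cases "?d x y = 0")
        case True
        obtain m where "m \<in> D" using ne by blast
        then show ?thesis using xy True by (auto simp: D_def)
      next
        case False
        then have pos: "?d x y > 0" using d[OF xy] by simp
        have "?e x y / ?d x y \<le> M"
          unfolding M_def
        proof (rule cInf_greatest[OF ne])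
          fix m assume "m \<in> D"
          then have "?e x y \<le> m * ?d x y" using xy by (auto simp: D_def)
          then show "?e x y / ?d x y \<le> m" using pos by (simp add: pos_divide_le_eq)
        qed
        then show ?thesis using pos by (simp add: pos_divide_le_eq)
      qed
      have "0 \<le> M" unfolding M_def by (rule cInf_greatest[OF ne]) (simp add: D_def)
      have M2: "0 \<le> ?d x y + M * ?e x y" if xy: "(x, y) \<in> S" for x y
      proof (cases "?e x y < 0")
        case True
        have "M \<le> ?d x y / (- ?e x y)"
          unfolding M_def by (rule cInf_lower[OF slope[OF xy True] bdd])
        then have "M * (- ?e x y) \<le> ?d x y" using True by (subst (asm) pos_le_divide_eq) auto
        then show ?thesis by (simp add: algebra_simps)
      next
        case False
        then show ?thesis using d[OF xy] \<open>0 \<le> M\<close> by simp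
      qed
      show ?thesis
      proof (rule normalize)
        \<comment> \<open>In \<open>(?d, ?e)\<close> coordinates the first side has direction
          \<open>(M, - 1)\<close>, perpendicular to slope \<open>M\<close>. Pairing it with
          \<open>(b, - a)\<close> gives a positive number, so it is nonzero.\<close>
        have "(M * a + b) * b + (M * b - a) * (- a) = a * a + b * b + M * (a * b - a * b)"
          by (simp add: algebra_simps)
        then show "(M * a + b, M * b - a) \<noteq> (0, 0)" using n by auto
        fix x y assume "(x, y) \<in> S"
        from M1[OF this] M2[OF this]
        show "0 \<le> (M * a + b) * x + (M * b - a) * y \<and> 0 \<le> (M * a + b) * y - (M * b - a) * x"
          by (simp add: algebra_simps)
      qed
    qed
  qed
qed

lemma sum_atLeastAtMost_add:
  fixes f :: "nat \<Rightarrow> 'b::comm_monoid_add"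
  shows "sum f {1..k + l} = sum f {1..k} + (\<Sum>j\<in>{1..l}. f (k + j))"
proof -
  have "sum f {1..k + l} = sum f {1..k} + sum f {k + 1..k + l}"
    by (rule sum.ub_add_nat) simp
  also have "sum f {k + 1..k + l} = (\<Sum>j\<in>{1..l}. f (k + j))"
    using sum.shift_bounds_cl_nat_ivl[of f 1 k l] by (simp add: add.commute)
  finally show ?thesis .
qed

lemma orthonormal_basis_append:
  assumes w: "orthonormal_basis k w W" and u: "orthonormal_basis l u R"
    and orth: "\<And>x y. x \<in> W \<Longrightarrow> y \<in> R \<Longrightarrow> x \<bullet> y = 0"
    and V: "subspace V" "W \<subseteq> V" "R \<subseteq> V" "\<And>v. v \<in> V \<Longrightarrow> \<exists>x\<in>W. v - x \<in> R"
  shows "orthonormal_basis (k + l) (\<lambda>i. if i \<le> k then w i else u (i - k)) V"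
proof -
  let ?X = "\<lambda>i. if i \<le> k then w i else u (i - k)"
  have "w i \<bullet> u j = 0" "u j \<bullet> w i = 0" if "i \<in> {1..k}" "j \<in> {1..l}" for i j
    using orth[OF onb_in[OF w that(1)] onb_in[OF u that(2)]] by (simp_all add: inner_commute)
  note wu = this
  have "?X i \<bullet> ?X j = (if i = j then 1 else 0)"
    if "i \<in> {1..k + l}" "j \<in> {1..k + l}" for i j
  proof -
    have "i \<in> {1..k} \<or> i - k \<in> {1..l} \<and> \<not> i \<le> k" "j \<in> {1..k} \<or> j - k \<in> {1..l} \<and> \<not> j \<le> k"
      using that by auto
    then show ?thesis
      using wu onb_inner[OF w] onb_inner[OF u] by (elim disjE conjE) auto
  qed
  moreover have img: "?X ` {1..k + l} = w ` {1..k} \<union> u ` {1..l}"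
  proof -
    have "{1..k + l} = {1..k} \<union> (\<lambda>j. k + j) ` {1..l}"
      by (auto simp: image_iff)
    moreover have "?X ` {1..k} = w ` {1..k}" by (intro image_cong) auto
    moreover have "?X ` (\<lambda>j. k + j) ` {1..l} = u ` {1..l}"
      unfolding image_image by (intro image_cong) auto
    ultimately show ?thesis by (simp only: image_Un)
  qed
  moreover have "span (w ` {1..k} \<union> u ` {1..l}) = V"
  proof
    have "w ` {1..k} \<subseteq> V" "u ` {1..l} \<subseteq> V"
      using onb_in[OF w] onb_in[OF u] V(2,3) by blast+
    then show "span (w ` {1..k} \<union> u ` {1..l}) \<subseteq> V"
      using V(1) by (simp add: span_minimal)
    show "V \<subseteq> span (w ` {1..k} \<union> u ` {1..l})"
    proof
      fix v assume "v \<in> V"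
      then obtain x where x: "x \<in> W" "v - x \<in> R" using V(4) by blast
      have "x \<in> span (w ` {1..k} \<union> u ` {1..l})" "v - x \<in> span (w ` {1..k} \<union> u ` {1..l})"
        using x onb_span[OF w] onb_span[OF u] by (meson span_mono subsetD sup_ge1 sup_ge2)+
      from span_add[OF this] show "v \<in> span (w ` {1..k} \<union> u ` {1..l})" by simp
    qed
  qed
  ultimately show ?thesis by (simp add: orthonormal_basis_def)
qed

section \<open>The complement \<open>R\<close> and the Hermitian forms given by bracket
  components\<close>

context abelian_cyclic
begin

definition R :: "'a set"
  where "R = {a \<in> V. \<forall>x\<in>W. x \<bullet> a = 0}"

lemma subspace_R: "subspace R"
  using subspace_V by (auto simp: R_def subspace_def inner_simps)

lemma dim_R: "dim V = dim W + dim R"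
  using dim_subspace_orthogonal_to_vectors[OF subspace_W subspace_V W_subset_V]
  by (simp add: R_def orthogonal_def)

lemma V_decomp: "v \<in> V \<Longrightarrow> \<exists>x\<in>W. v - x \<in> R"
proof -
  assume v: "v \<in> V"
  obtain y z where yz: "y \<in> span W" "\<And>w. w \<in> span W \<Longrightarrow> orthogonal z w" "v = y + z"
    using orthogonal_subspace_decomp_exists[of W v] by blast
  then have y: "y \<in> W" using subspace_W by (metis span_eq_iff)
  then have "z \<in> V" using yz(3) v W_subset_V
    by (metis add_diff_cancel_left' subsetD subspace_V subspace_diff)
  then have "z \<in> R" using yz(2) by (auto simp: R_def orthogonal_def span_base inner_commute)
  then show ?thesis using y yz(3) by (intro bexI[of _ y]) simp_all
qed

text \<open>For fixed \<open>u\<close>, the map \<open>(y, z) \<mapsto> u \<bullet> [J y, z]\<close> is a \<open>J\<close>-invariant symmetric bilinear form;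
  the next lemma is its Cauchy--Schwarz inequality.\<close>

lemma star_cauchy_schwarz:
  assumes psd: "\<And>v. 0 \<le> u \<bullet> br (J v) v"
  shows "(u \<bullet> br (J v) w)\<^sup>2 + (u \<bullet> br v w)\<^sup>2 \<le> (u \<bullet> br (J v) v) * (u \<bullet> br (J w) w)"
proof -
  let ?G = "\<lambda>x y. u \<bullet> br (J x) y"
  define a b where "a = ?G v w" and "b = u \<bullet> br v w"
  \<comment> \<open>This is the Hermitian norm of \<open>h v\<close> minus a complex multiple of
    \<open>w\<close>. With \<open>h = ?G w w\<close>, \<open>s = a\<close>, \<open>t = b\<close> it
    is the usual minimising choice cleared of denominators; \<open>expand'\<close> swaps the roles
    when \<open>?G w w = 0\<close>.\<close>
  have expand: "?G (h *\<^sub>R v - s *\<^sub>R w - t *\<^sub>R J w) (h *\<^sub>R v - s *\<^sub>R w - t *\<^sub>R J w)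
    = h\<^sup>2 * ?G v v - 2 * h * (s * a + t * b) + (s\<^sup>2 + t\<^sup>2) * ?G w w" for h s t
    using star_commute[of w v] br_J_right[of v w] br_swap[of w v] br_J_right[of w w]
      br_J_right[of w "v"] br_J_J[of v w]
    by (simp add: J_simps br_simps inner_simps a_def b_def power2_eq_square algebra_simps br_J_J)
  have expand': "?G (h *\<^sub>R w - s *\<^sub>R v - t *\<^sub>R J v) (h *\<^sub>R w - s *\<^sub>R v - t *\<^sub>R J v)
    = h\<^sup>2 * ?G w w - 2 * h * (s * a - t * b) + (s\<^sup>2 + t\<^sup>2) * ?G v v" for h s t
    using star_commute[of w v] br_J_right[of v w] br_swap[of w v] br_J_right[of v v]
      br_J_right[of w "v"] br_J_J[of v w]
    by (simp add: J_simps br_simps inner_simps a_def b_def power2_eq_square algebra_simps br_J_J)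
  have "a\<^sup>2 + b\<^sup>2 \<le> ?G v v * ?G w w"
  proof (cases "?G w w = 0")
    case False
    then have h: "?G w w > 0" using psd[of w] by simp
    have "0 \<le> ?G w w * (?G v v * ?G w w - (a\<^sup>2 + b\<^sup>2))"
      using expand[of "?G w w" a b] psd[of "?G w w *\<^sub>R v - a *\<^sub>R w - b *\<^sub>R J w"]
      by (simp add: power2_eq_square algebra_simps)
    then show ?thesis using h by (simp add: zero_le_mult_iff)
  next
    case w0: True
    show ?thesis
    proof (cases "?G v v = 0")
      case False
      then have h: "?G v v > 0" using psd[of v] by simp
      have "0 \<le> ?G v v * (?G v v * ?G w w - (a\<^sup>2 + b\<^sup>2))"
        using expand'[of "?G v v" a "-b"] psd[of "?G v v *\<^sub>R w - a *\<^sub>R v - (-b) *\<^sub>R J v"]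
        by (simp add: power2_eq_square algebra_simps)
      then show ?thesis using h by (simp add: zero_le_mult_iff)
    next
      case True
      then have "0 \<le> - 2 * (a\<^sup>2 + b\<^sup>2)"
        using expand[of 1 a b] psd[of "1 *\<^sub>R v - a *\<^sub>R w - b *\<^sub>R J w"] w0
        by (simp add: power2_eq_square algebra_simps)
      then show ?thesis using True w0 by simp
    qed
  qed
  then show ?thesis by (simp add: a_def b_def)
qed

text \<open>Equality in the Cauchy--Schwarz inequality means that the form has complex rank one.\<close>

lemma star_rank_one:
  assumes psd: "\<And>v. 0 \<le> u \<bullet> br (J v) v" and u: "u \<in> V" "u \<noteq> 0"
    and eq: "\<And>v w. (u \<bullet> br (J v) v) * (u \<bullet> br (J w) w)
      = (u \<bullet> br (J v) w)\<^sup>2 + (u \<bullet> br v w)\<^sup>2"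
  obtains c x where "\<And>y z. u \<bullet> br y z
    = wedge (\<lambda>y. c * (u \<bullet> br x y)) (\<lambda>y. c * (u \<bullet> br x (J y))) y z"
proof -
  \<comment> \<open>Otherwise equality makes \<open>u\<close> orthogonal to all brackets, hence to
    \<open>V\<close>, which contains \<open>u\<close>.\<close>
  have "\<exists>v. u \<bullet> br (J v) v \<noteq> 0"
  proof (rule ccontr)
    assume "\<not> ?thesis"
    then have zero: "u \<bullet> br v w = 0" for v w
      using eq[of v w] by simp
    have "u \<bullet> v = 0" if "v \<in> V" for v
      using that by (induction rule: V_induct) (auto simp: inner_simps zero)
    then show False using u by force
  qed
  then obtain v where v: "u \<bullet> br (J v) v > 0" using psd by (metis order_le_less)
  \<comment> \<open>With this normalisation, equality for the pair \<open>v, y\<close> says that the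
    form at \<open>y\<close> is the squared modulus of
    \<open>\<alpha> y + i \<alpha> (J y)\<close>.\<close>
  define c where "c = 1 / sqrt (u \<bullet> br (J v) v)"
  define \<alpha> where "\<alpha> y = c * (u \<bullet> br (J v) y)" for y
  have \<alpha>J: "\<alpha> (J y) = c * (u \<bullet> br v y)" for y by (simp add: \<alpha>_def br_J_J)
  have c2: "c * c * (u \<bullet> br (J v) v) = 1" "c \<noteq> 0"
    using v by (simp_all add: c_def)
  have lin: "\<alpha> (y + z) = \<alpha> y + \<alpha> z" for y z
    by (simp add: \<alpha>_def br_simps inner_simps algebra_simps)
  have diag: "u \<bullet> br (J y) y = (\<alpha> y)\<^sup>2 + (\<alpha> (J y))\<^sup>2" for y
  proof -
    have "(\<alpha> y)\<^sup>2 + (\<alpha> (J y))\<^sup>2 = c * c * ((u \<bullet> br (J v) y)\<^sup>2 + (u \<bullet> br v y)\<^sup>2)"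
      unfolding \<alpha>J by (simp add: \<alpha>_def power2_eq_square algebra_simps)
    also have "\<dots> = c * c * (u \<bullet> br (J v) v) * (u \<bullet> br (J y) y)"
      unfolding eq[of v y, symmetric] by simp
    finally show ?thesis using c2(1) by simp
  qed
  have polar: "u \<bullet> br (J y) z = \<alpha> y * \<alpha> z + \<alpha> (J y) * \<alpha> (J z)" for y z
    using diag[of "y + z"] diag[of y] diag[of z] star_commute[of z y]
    by (simp add: J_simps br_simps inner_simps lin power2_eq_square algebra_simps)
  have wedge: "u \<bullet> br y z = wedge \<alpha> (\<lambda>y. \<alpha> (J y)) y z" for y z
  proof -
    have "\<alpha> (- y) = - \<alpha> y" for y by (simp add: \<alpha>_def br_simps)
    then show ?thesis
      using polar[of "- J y" z] polar[of "J y" z] by (simp add: J_simps br_simps wedge_def)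
  qed
  \<comment> \<open>The functional stays explicit, with \<open>x = J v\<close>, so that its
    linearity and its vanishing on \<open>V\<close> and \<open>J V\<close> can be read off
    later.\<close>
  show ?thesis by (rule that[of c "J v"]) (fact wedge[unfolded \<alpha>_def])
qed

end

lemma sum_fun_apply: "(\<Sum>i\<in>I. f i) x = (\<Sum>i\<in>I. f i x)"
  by (induction I rule: infinite_finite_induct) simp_all

definition restrict_form :: "'a set \<Rightarrow> ('a \<Rightarrow> real) \<Rightarrow> 'a \<Rightarrow> real"
  where "restrict_form U f x = (if x \<in> U then f x else 0)"

lemma restrict_form_in_dual_space:
  assumes "subspace U" "linear f"
  shows "restrict_form U f \<in> dual_space U"
  using assms
  by (auto simp: dual_space_def restrict_form_def subspace_add subspace_scale linear_add linear_scale)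

section \<open>The decomposition into \<open>V\<close>, \<open>J V\<close> and \<open>U\<close>, and
  the normal form\<close>

context almost_hermitian_lie_algebra
begin

abbreviation U :: "'a set" where "U \<equiv> U_J br J"

lemma subspace_U: "subspace U"
  unfolding U_J_def by (rule subspace_orthogonal_comp)

lemma V_JV_eq: "{x + J y | x y. x \<in> V \<and> y \<in> V} = {x + y | x y. x \<in> V \<and> y \<in> J ` V}"
  by blast

lemma subspace_JV: "subspace (J ` V)"
  by (rule linear_subspace_image[OF linear_J subspace_V])

lemma subspace_V_JV: "subspace {x + J y | x y. x \<in> V \<and> y \<in> V}"
  unfolding V_JV_eq by (rule subspace_sums[OF subspace_V subspace_JV])

lemma V_JV_U_decomp:
  obtains v v' r where "v \<in> V" "v' \<in> V" "r \<in> U" "x = v + J v' + r"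
proof -
  have "x \<in> {x + J y | x y. x \<in> V \<and> y \<in> V} + U"
    using subspace_sum_orthogonal_comp[OF subspace_V_JV] by (simp add: U_J_def)
  then show ?thesis using that by (elim set_plus_elim) blast
qed

lemma U_iff: "x \<in> U \<longleftrightarrow> (\<forall>v\<in>V. v \<bullet> x = 0 \<and> J v \<bullet> x = 0)"
proof
  assume x: "x \<in> U"
  have orth: "(v + J v') \<bullet> x = 0" if "v \<in> V" "v' \<in> V" for v v'
    using x that by (auto simp: U_J_def orthogonal_comp_def orthogonal_def)
  show "\<forall>v\<in>V. v \<bullet> x = 0 \<and> J v \<bullet> x = 0"
    using orth[OF _ subspace_0[OF subspace_V]] orth[OF subspace_0[OF subspace_V]]
    by (simp add: J_simps)
qed (auto simp: U_J_def orthogonal_comp_def orthogonal_def inner_simps)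

lemma J_in_U: "x \<in> U \<Longrightarrow> J x \<in> U"
  using inner_J_left[of _ x] by (simp add: U_iff inner_J_J)

text \<open>Uniform in the codimension \<open>l\<close>, with \<open>m = k + l\<close>.
  Non-degeneracy of \<open>\<alpha>\<close> is stated separately, as
  \<open>complex_independent\<close>.\<close>

definition normal_form :: "nat \<Rightarrow> nat \<Rightarrow> (nat \<Rightarrow> 'a) \<Rightarrow> (nat \<Rightarrow> real) \<Rightarrow> (nat \<Rightarrow> 'a \<Rightarrow> real) \<Rightarrow>
    (nat \<Rightarrow> 'a \<Rightarrow> real) \<Rightarrow> bool"
  where "normal_form k l X lam mu \<alpha> \<longleftrightarrow>
    orthonormal_basis (k + l) X V \<and>
    (\<forall>i\<in>{1..k}. lam i \<noteq> 0 \<and> mu i \<in> dual_space U) \<and>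
    (\<forall>i\<in>{1..l}. \<alpha> i \<in> dual_space U) \<and>
    normal_brackets br J U (k + l) k X lam mu \<and>
    (\<forall>Y\<in>U. \<forall>Z\<in>U. br Y Z = (\<Sum>i=1..k. (1 / lam i * wedge (mu i) (mu i \<circ> J) Y Z) *\<^sub>R X i)
      + (\<Sum>i=1..l. wedge (\<alpha> i) (\<alpha> i \<circ> J) Y Z *\<^sub>R X (k + i)))"

end

context abelian_cyclic
begin

lemma R_subset_V: "R \<subseteq> V"
  by (auto simp: R_def)

theorem normal_form_exists:
  assumes l: "dim V = dim W + l" "l \<in> {1, 2}"
  obtains X lam mu \<alpha> where "normal_form (dim W) l X lam mu \<alpha>" "complex_independent J {1..l} \<alpha>"
proof -
  define k where "k = dim W"
  obtain w where w: "orthonormal_basis k w W"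
    and lam: "\<And>i. i \<in> {1..k} \<Longrightarrow> ad_coeff (w i) (J (w i)) \<noteq> 0"
    and ad: "\<And>i y. i \<in> {1..k} \<Longrightarrow> br y (w i) = ad_coeff (w i) y *\<^sub>R w i"
    and wbr: "\<And>i y z. i \<in> {1..k} \<Longrightarrow> ad_coeff (w i) (J (w i)) * (w i \<bullet> br y z) =
        ad_coeff (w i) y * ad_coeff (w i) (J z) - ad_coeff (w i) z * ad_coeff (w i) (J y)"
    and star0: "\<And>i j. i \<in> {1..k} \<Longrightarrow> j \<in> {1..k} \<Longrightarrow> i \<noteq> j \<Longrightarrow> br (J (w i)) (w j) = 0"
    and central: "\<And>a y. a \<in> V \<Longrightarrow> (\<And>x. x \<in> W \<Longrightarrow> x \<bullet> a = 0) \<Longrightarrow> br y a = 0"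
    using eigenbasis_structure unfolding k_def by blast
  have R0: "br y a = 0" if "a \<in> R" for a y using that central by (simp add: R_def)
  have WR: "x \<bullet> y = 0" if "x \<in> W" "y \<in> R" for x y using that by (simp add: R_def)
  have wV: "w i \<in> V" if "i \<in> {1..k}" for i using onb_in[OF w that] W_subset_V by blast
  have dimR: "dim R = l" using l(1) dim_R by simp

  have onbV: "orthonormal_basis (k + l) (\<lambda>i. if i \<le> k then w i else u (i - k)) V"
    if "orthonormal_basis l u R" for u
    by (rule orthonormal_basis_append[OF w that WR subspace_V W_subset_V R_subset_V V_decomp])

  \<comment> \<open>The SKT identity at \<open>(J x, x, J y, y)\<close> holds for the sum over all
    components. Each \<open>w i\<close> component satisfies it alone, being a multiple of a
    decomposable form, so it remains true for the sum over \<open>R\<close>.\<close>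
  have R_sum: "(\<Sum>j\<in>{1..l}. (u j \<bullet> br (J x) x) * (u j \<bullet> br (J y) y))
      = (\<Sum>j\<in>{1..l}. (u j \<bullet> br (J x) y)\<^sup>2 + (u j \<bullet> br x y)\<^sup>2)"
    if u: "orthonormal_basis l u R" for u x y
  proof -
    have split: "v \<bullet> z = (\<Sum>i\<in>{1..k}. (w i \<bullet> v) * (w i \<bullet> z)) + (\<Sum>j\<in>{1..l}. (u j \<bullet> v) * (u j \<bullet> z))"
      if "v \<in> V" for v z
      unfolding onb_inner_expand[OF onbV[OF u] that] sum_atLeastAtMost_add by simp
    have "br (J x) x \<bullet> br (J y) y = br x y \<bullet> br x y + br (J x) y \<bullet> br (J x) y"
      using cyclic[of "J x" x "J y" y] by (simp add: br_J_J br_J_right[of x])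
    moreover have "(w i \<bullet> br (J x) x) * (w i \<bullet> br (J y) y)
        = (w i \<bullet> br x y) * (w i \<bullet> br x y) + (w i \<bullet> br (J x) y) * (w i \<bullet> br (J x) y)"
      if i: "i \<in> {1..k}" for i
    proof -
      let ?n = "ad_coeff (w i)" and ?l = "ad_coeff (w i) (J (w i))"
      have neg: "?n (- z) = - ?n z" for z using ad_coeff_scaleR[of "w i" "- 1" z] by simp
      have "?l * ?l * ((w i \<bullet> br (J x) x) * (w i \<bullet> br (J y) y))
        = (?l * (w i \<bullet> br (J x) x)) * (?l * (w i \<bullet> br (J y) y))" by simp
      also have "\<dots> = (?l * (w i \<bullet> br x y)) * (?l * (w i \<bullet> br x y))
          + (?l * (w i \<bullet> br (J x) y)) * (?l * (w i \<bullet> br (J x) y))"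
        unfolding wbr[OF i] J_J neg by (simp add: algebra_simps)
      also have "\<dots> = ?l * ?l * ((w i \<bullet> br x y) * (w i \<bullet> br x y)
          + (w i \<bullet> br (J x) y) * (w i \<bullet> br (J x) y))" by (simp add: algebra_simps)
      finally show ?thesis using lam[OF i] by simp
    qed
    ultimately show ?thesis
      unfolding split[OF br_in_V] by (simp add: sum.distrib power2_eq_square)
  qed

  have "\<exists>u. orthonormal_basis l u R \<and> (\<forall>j\<in>{1..l}. \<forall>x. 0 \<le> u j \<bullet> br (J x) x)"
  proof -
    obtain p where p: "orthonormal_basis l p R"
      using orthonormal_basis_exists[OF subspace_R] dimR by metis
    have acute: "0 \<le> (\<Sum>j\<in>{1..l}. (p j \<bullet> br (J x) x) * (p j \<bullet> br (J y) y))" for x y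
      unfolding R_sum[OF p] by (intro sum_nonneg) simp
    consider "l = 1" | "l = 2" using l(2) by blast
    then show ?thesis
    proof cases
      case 1
      show ?thesis
      proof (cases "\<forall>x. 0 \<le> p 1 \<bullet> br (J x) x")
        case True
        then show ?thesis using p 1 by auto
      next
        case False
        then obtain x where x: "p 1 \<bullet> br (J x) x < 0" by (auto simp: not_le)
        have "p 1 \<bullet> br (J y) y \<le> 0" for y
          using acute[of x y] x 1 by (simp add: zero_le_mult_iff)
        moreover have "orthonormal_basis 1 (\<lambda>j. - p j) R"
        proof -
          have "span {- p 1} = span {p 1}"
          proof -
            have "- p 1 \<in> span {p 1}" by (intro span_neg span_base) simp
            moreover have "p 1 \<in> span {- p 1}"
              using span_neg[OF span_base[of "- p 1" "{- p 1}"]] by simp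
            ultimately show ?thesis by (simp add: span_eq)
          qed
          then show ?thesis using p 1 by (simp add: orthonormal_basis_def)
        qed
        ultimately show ?thesis using 1 by (intro exI[of _ "\<lambda>j. - p j"]) auto
      qed
    next
      case 2
      have two: "{1..2::nat} = {1, 2}" "{Suc 0..2} = {1, 2}" by auto
      let ?q = "\<lambda>x. (p 1 \<bullet> br (J x) x, p 2 \<bullet> br (J x) x)"
      have "0 \<le> a * a' + b * b'" if "(a, b) \<in> range ?q" "(a', b') \<in> range ?q" for a b a' b'
        using that acute 2 by (auto simp: two)
      note acute' = this
      obtain c s where cs: "c\<^sup>2 + s\<^sup>2 = 1"
        "\<And>a b. (a, b) \<in> range ?q \<Longrightarrow> 0 \<le> c * a + s * b \<and> 0 \<le> c * b - s * a"
        by (rule acute_imp_quadrant[of "range ?q"]) (rule acute' that, assumption+)+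
      \<comment> \<open>The basis \<open>p\<close> rotated onto the sides of the quadrant, which
        makes both components of \<open>[J x, x]\<close> nonnegative.\<close>
      define u where "u j = (if j = (1::nat) then c *\<^sub>R p 1 + s *\<^sub>R p 2 else c *\<^sub>R p 2 - s *\<^sub>R p 1)"
        for j
      have pp: "p 1 \<bullet> p 1 = 1" "p 2 \<bullet> p 2 = 1" "p 1 \<bullet> p 2 = 0" "p 2 \<bullet> p 1 = 0"
        using onb_inner[OF p] 2 by auto
      have "span {u 1, u 2} = span {p 1, p 2}"
      proof
        have "c *\<^sub>R p 1 + s *\<^sub>R p 2 \<in> span {p 1, p 2}" "c *\<^sub>R p 2 - s *\<^sub>R p 1 \<in> span {p 1, p 2}"
          by (intro span_add span_diff span_scale span_base; simp)+
        then show "span {u 1, u 2} \<subseteq> span {p 1, p 2}"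
          by (simp add: span_minimal u_def)
        have "c *\<^sub>R u 1 - s *\<^sub>R u 2 = (c\<^sup>2 + s\<^sup>2) *\<^sub>R p 1"
          and "s *\<^sub>R u 1 + c *\<^sub>R u 2 = (c\<^sup>2 + s\<^sup>2) *\<^sub>R p 2"
          by (simp_all add: u_def algebra_simps power2_eq_square)
        then have "p 1 = c *\<^sub>R u 1 - s *\<^sub>R u 2" "p 2 = s *\<^sub>R u 1 + c *\<^sub>R u 2"
          using cs(1) by simp_all
        moreover have "c *\<^sub>R u 1 - s *\<^sub>R u 2 \<in> span {u 1, u 2}"
          "s *\<^sub>R u 1 + c *\<^sub>R u 2 \<in> span {u 1, u 2}"
          by (intro span_add span_diff span_scale span_base; simp)+
        ultimately have "{p 1, p 2} \<subseteq> span {u 1, u 2}" by simp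
        then show "span {p 1, p 2} \<subseteq> span {u 1, u 2}"
          by (simp only: span_minimal subspace_span)
      qed
      then have "span (u ` {1..2}) = R" using onb_span[OF p] 2 by (simp add: two)
      moreover have "u i \<bullet> u j = (if i = j then 1 else 0)" if "i \<in> {1..2}" "j \<in> {1..2}" for i j
        using that cs(1) unfolding two
        by (auto simp: u_def inner_simps pp pp[unfolded One_nat_def] power2_eq_square algebra_simps)
      ultimately have "orthonormal_basis l u R" using 2 by (simp add: orthonormal_basis_def)
      moreover have "0 \<le> u j \<bullet> br (J x) x" if "j \<in> {1..l}" for j x
        using that cs(2)[OF rangeI, of x] 2 by (simp add: u_def inner_simps)
      ultimately show ?thesis by blast
    qed
  qed
  then obtain u where u: "orthonormal_basis l u R"
    and psd: "\<And>j x. j \<in> {1..l} \<Longrightarrow> 0 \<le> u j \<bullet> br (J x) x" by blast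
  have uR: "u j \<in> R" if "j \<in> {1..l}" for j using onb_in[OF u that] .
  have uV: "u j \<in> V" if "j \<in> {1..l}" for j using uR[OF that] R_subset_V by blast
  have u0: "u j \<noteq> 0" if "j \<in> {1..l}" for j using onb_inner[OF u that that] by auto
  \<comment> \<open>\<open>R_sum\<close> gives equality only for the sum over \<open>j\<close>;
    since Cauchy-Schwarz bounds every summand in the same direction, each one is an
    equality.\<close>
  have rank: "(u j \<bullet> br (J x) x) * (u j \<bullet> br (J y) y) = (u j \<bullet> br (J x) y)\<^sup>2 + (u j \<bullet> br x y)\<^sup>2"
    if j: "j \<in> {1..l}" for j x y
  proof -
    have "(\<Sum>j\<in>{1..l}. (u j \<bullet> br (J x) x) * (u j \<bullet> br (J y) y)
        - ((u j \<bullet> br (J x) y)\<^sup>2 + (u j \<bullet> br x y)\<^sup>2)) = 0"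
      using R_sum[OF u, of x y] by (simp add: sum_subtractf)
    then show ?thesis
      using star_cauchy_schwarz[OF psd] j by (subst (asm) sum_nonneg_eq_0_iff) auto
  qed
  have "\<forall>j\<in>{1..l}. \<exists>c x. \<forall>y z. u j \<bullet> br y z
      = wedge (\<lambda>y. c * (u j \<bullet> br x y)) (\<lambda>y. c * (u j \<bullet> br x (J y))) y z"
    using star_rank_one[OF psd uV u0 rank] by metis
  then have "\<exists>c x. \<forall>j\<in>{1..l}. \<forall>y z. u j \<bullet> br y z
      = wedge (\<lambda>y. c j * (u j \<bullet> br (x j) y)) (\<lambda>y. c j * (u j \<bullet> br (x j) (J y))) y z"
    unfolding bchoice_iff .
  then obtain c x where cx: "\<forall>j\<in>{1..l}. \<forall>y z. u j \<bullet> br y z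
      = wedge (\<lambda>y. c j * (u j \<bullet> br (x j) y)) (\<lambda>y. c j * (u j \<bullet> br (x j) (J y))) y z"
    by (elim exE)
  define A where "A j y = c j * (u j \<bullet> br (x j) y)" for j y
  have A: "u j \<bullet> br y z = wedge (A j) (A j \<circ> J) y z" if "j \<in> {1..l}" for j y z
    using cx[rule_format, OF that, of y z] by (simp add: A_def wedge_def)
  have linA: "linear (A j)" for j
    by (rule linearI) (simp_all add: A_def br_simps inner_simps algebra_simps)
  have linN: "linear (ad_coeff (w i))" for i
    by (rule linearI) (simp_all add: ad_coeff_add ad_coeff_scaleR)
  \<comment> \<open>\<open>R\<close> is central and every adjoint map preserves \<open>W\<close>.
    Hence \<open>A j\<close> vanishes on \<open>V\<close> and \<open>J V\<close>, and a complex
    relation among the \<open>A j\<close> on \<open>U\<close> extends to the whole algebra.\<close>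
  have uadV: "u j \<bullet> br y v = 0" if j: "j \<in> {1..l}" and v: "v \<in> V" for j y v
  proof -
    obtain v' where v': "v' \<in> W" "v - v' \<in> R" using V_decomp[OF v] by blast
    have "br y v = br y v'" using R0[OF v'(2), of y] by (simp add: br_simps)
    also have "\<dots> = (\<Sum>i\<in>{1..k}. (w i \<bullet> v') *\<^sub>R br y (w i))"
      by (subst onb_expand[OF w v'(1)])
        (simp add: linear_sum[OF linear_br_right] linear_scale[OF linear_br_right])
    also have "\<dots> \<in> W"
      by (intro subspace_sum subspace_W subspace_scale)
        (use ad onb_in[OF w] in \<open>simp add: subspace_scale subspace_W\<close>)
    finally show ?thesis using WR[OF _ uR[OF j], of "br y v"] by (simp add: inner_commute)
  qed
  have AV: "A j (v + J v' + r) = A j r" "A j (J (v + J v' + r)) = A j (J r)"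
    if "j \<in> {1..l}" "v \<in> V" "v' \<in> V" for j v v' r
    using that uadV
    by (simp_all add: A_def br_simps J_simps inner_simps br_J_right)

  define X where "X = (\<lambda>i. if i \<le> k then w i else u (i - k))"
  define lam where "lam i = ad_coeff (w i) (J (w i))" for i
  define mu where "mu i = restrict_form U (ad_coeff (w i))" for i
  define \<alpha> where "\<alpha> j = restrict_form U (A j)" for j

  have XR: "X i \<in> R" if "i \<in> {1..k + l}" "\<not> i \<le> k" for i
  proof -
    have "i - k \<in> {1..l}" using that by auto
    then show ?thesis using that uR by (simp add: X_def)
  qed
  have onbX: "orthonormal_basis (k + l) X V" using onbV[OF u] by (simp add: X_def)
  have nb: "normal_brackets br J U (k + l) k X lam mu"
    unfolding normal_brackets_def
  proof (intro conjI ballI)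
    fix i j assume ij: "i \<in> {1..k + l}" "j \<in> {1..k + l}"
    show "br (X i) (X j) = 0" "br (J (X i)) (J (X j)) = 0"
      using br_V_V onb_in[OF onbX] ij by (simp_all add: br_J_J)
    show "br (J (X i)) (X j) = (if i = j \<and> i \<le> k then lam i *\<^sub>R X i else 0)"
    proof (cases "i \<le> k \<and> j \<le> k")
      case True
      then show ?thesis
        using ij ad[of i "J (w i)"] star0[of i j] by (auto simp: X_def lam_def)
    next
      case False
      then have "br (J (X i)) (X j) = 0"
        using XR[OF ij(1)] XR[OF ij(2)] R0 star_commute[of "X i" "X j"] by metis
      then show ?thesis using False by auto
    qed
  next
    fix Y i assume Y: "Y \<in> U" and i: "i \<in> {1..k + l}"
    have "br Y (X i) = (if i \<le> k then ad_coeff (w i) Y *\<^sub>R X i else 0)" for Y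
      using i ad[of i Y] R0[OF XR[OF i]] by (auto simp: X_def)
    then show "br Y (X i) = (if i \<le> k then mu i Y *\<^sub>R X i else 0)"
      "br Y (J (X i)) = (if i \<le> k then (- mu i (J Y)) *\<^sub>R X i else 0)"
      using Y J_in_U[OF Y] by (simp_all add: mu_def restrict_form_def br_J_right)
  qed
  have brU: "br Y Z = (\<Sum>i=1..k. (1 / lam i * wedge (mu i) (mu i \<circ> J) Y Z) *\<^sub>R X i)
      + (\<Sum>i=1..l. wedge (\<alpha> i) (\<alpha> i \<circ> J) Y Z *\<^sub>R X (k + i))" if Y: "Y \<in> U" and Z: "Z \<in> U" for Y Z
  proof -
    have "br Y Z = (\<Sum>i\<in>{1..k}. (X i \<bullet> br Y Z) *\<^sub>R X i)
        + (\<Sum>j\<in>{1..l}. (X (k + j) \<bullet> br Y Z) *\<^sub>R X (k + j))"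
      using onb_expand[OF onbX br_in_V[of Y Z]] unfolding sum_atLeastAtMost_add .
    moreover have "X i \<bullet> br Y Z = 1 / lam i * wedge (mu i) (mu i \<circ> J) Y Z" if "i \<in> {1..k}" for i
      using wbr[OF that, of Y Z] lam[OF that] that Y Z J_in_U[OF Y] J_in_U[OF Z]
      by (simp add: X_def lam_def mu_def restrict_form_def wedge_def field_simps)
    moreover have "X (k + j) \<bullet> br Y Z = wedge (\<alpha> j) (\<alpha> j \<circ> J) Y Z" if "j \<in> {1..l}" for j
      using A[OF that, of Y Z] that Y Z J_in_U[OF Y] J_in_U[OF Z]
      by (simp add: X_def \<alpha>_def restrict_form_def wedge_def)
    ultimately show ?thesis by simp
  qed
  have "normal_form k l X lam mu \<alpha>"
    using onbX nb brU lam restrict_form_in_dual_space[OF subspace_U] linN linA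
    by (simp add: normal_form_def lam_def mu_def \<alpha>_def)
  moreover have "complex_independent J {1..l} \<alpha>"
    unfolding complex_independent_def
  proof (intro allI impI)
    fix z :: "nat \<Rightarrow> complex"
    assume 0: "(\<Sum>i\<in>{1..l}. cscale_form J (z i) (\<alpha> i)) = 0"
    define B where "B j y = Re (z j) * A j y + Im (z j) * A j (J y)" for j y
    have B0: "(\<Sum>j\<in>{1..l}. B j y) = 0" for y
    proof -
      obtain v v' r where r: "v \<in> V" "v' \<in> V" "r \<in> U" "y = v + J v' + r"
        using V_JV_U_decomp by blast
      have "(\<Sum>j\<in>{1..l}. B j y) = (\<Sum>j\<in>{1..l}. cscale_form J (z j) (\<alpha> j) r)"
        using r J_in_U[OF r(3)] AV
        by (intro sum.cong refl) (simp add: B_def cscale_form_def \<alpha>_def restrict_form_def)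
      also have "\<dots> = (\<Sum>j\<in>{1..l}. cscale_form J (z j) (\<alpha> j)) r"
        by (simp only: sum_fun_apply)
      finally show ?thesis unfolding 0 by simp
    qed
    \<comment> \<open>Multiplication by \<open>z\<close> acts on the pair \<open>A j\<close>,
      \<open>A j \<circ> J\<close> as a rotation scaled by the modulus, so the wedge scales by the
      squared modulus.\<close>
    have B: "wedge (B j) (B j \<circ> J) y y' = (cmod (z j))\<^sup>2 * (u j \<bullet> br y y')" if "j \<in> {1..l}" for j y y'
      unfolding A[OF that] cmod_power2
      by (simp add: wedge_def B_def J_simps linear_neg[OF linA] power2_eq_square algebra_simps)
    have zero: "a = 0" if "a \<in> V" "\<And>y y'. a \<bullet> br y y' = 0" for a
    proof -
      have "a \<bullet> v = 0" if "v \<in> V" for v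
        using that by (induction rule: V_induct)
          (simp_all add: inner_simps \<open>\<And>y y'. a \<bullet> br y y' = 0\<close>)
      then show ?thesis using that(1) by force
    qed
    consider "l = 1" | "l = 2" using l(2) by blast
    then show "\<forall>j\<in>{1..l}. z j = 0"
    proof cases
      case 1
      then have "B 1 = (\<lambda>_. 0)" using B0 by auto
      then have "(cmod (z 1))\<^sup>2 *\<^sub>R u 1 = 0"
        using B[of 1] 1 uV[of 1] subspace_V by (intro zero) (simp_all add: subspace_scale wedge_def)
      then show ?thesis using u0[of 1] 1 by simp
    next
      case 2
      have two: "{1..2::nat} = {1, 2}" "{Suc 0..2} = {1, 2}" by auto
      have "B 1 = (\<lambda>y. - B 2 y)" using B0 2 by (auto simp: two fun_eq_iff eq_neg_iff_add_eq_0)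
      then have "wedge (B 1) (B 1 \<circ> J) y y' = wedge (B 2) (B 2 \<circ> J) y y'" for y y'
        by (simp add: wedge_def)
      \<comment> \<open>The two wedges agree, so this vector of \<open>V\<close> is orthogonal to
        all brackets; orthonormality of \<open>u 1\<close>, \<open>u 2\<close> then kills both
        coefficients.\<close>
      then have "(cmod (z 1))\<^sup>2 *\<^sub>R u 1 - (cmod (z 2))\<^sup>2 *\<^sub>R u 2 = 0"
        using B[of 1] B[of 2] 2 uV[of 1] uV[of 2] subspace_V
        by (intro zero) (simp_all add: subspace_scale subspace_diff inner_simps)
      then have "u i \<bullet> ((cmod (z 1))\<^sup>2 *\<^sub>R u 1 - (cmod (z 2))\<^sup>2 *\<^sub>R u 2) = 0" for i by simp
      from this[of 1] this[of 2] have "z 1 = 0" "z 2 = 0"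
        using onb_inner[OF u] 2 by (simp_all add: inner_simps)
      then show ?thesis using 2 by (auto simp: two)
    qed
  qed
  ultimately show ?thesis using that unfolding k_def by blast
qed

end

section \<open>Consequences of the normal form\<close>

text \<open>The Pluecker relation: a decomposable two-form has square zero.\<close>

lemma wedge_cyclic:
  "wedge a b x y * wedge a b z w - wedge a b x z * wedge a b y w + wedge a b x w * wedge a b y z = 0"
  by (simp add: wedge_def algebra_simps)

lemma linear_coordinate_sum:
  fixes X :: "nat \<Rightarrow> 'a::real_inner"
  shows "linear (\<lambda>v. \<Sum>i\<in>I. (c i * (X i \<bullet> v)) *\<^sub>R X i)"
  by (rule linearI)
    (simp_all add: inner_simps algebra_simps sum.distrib scaleR_sum_right)

context almost_hermitian_lie_algebra
begin

lemma V_JV_U_unique: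
  assumes "totally_real J V"
    and "v1 \<in> V" "v1' \<in> V" "r1 \<in> U" "v2 \<in> V" "v2' \<in> V" "r2 \<in> U"
    and "v1 + J v1' + r1 = v2 + J v2' + r2"
  shows "v1 = v2" "v1' = v2'" "r1 = r2"
proof -
  let ?v = "v1 - v2" and ?v' = "v1' - v2'" and ?r = "r2 - r1"
  have mem: "?v \<in> V" "?v' \<in> V" "?r \<in> U"
    using assms by (simp_all add: subspace_diff subspace_V subspace_U)
  have eq: "?r = ?v + J ?v'" using assms(8) by (simp add: J_simps algebra_simps)
  have "?v \<bullet> ?r = 0" "J ?v' \<bullet> ?r = 0" using mem U_iff by blast+
  then have "?r \<bullet> ?r = 0" by (subst (1) eq) (simp only: inner_add_left)
  then have r: "?r = 0" by simp
  then have "?v + J ?v' = 0" using eq by simp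
  then have "?v = J (- ?v')" unfolding linear_neg[OF linear_J] by (simp only: eq_neg_iff_add_eq_0)
  moreover have "- ?v' \<in> V" using mem(2) by (rule subspace_neg[OF subspace_V])
  ultimately have "?v \<in> V \<inter> J ` V" using mem(1) by blast
  then have v: "?v = 0" using assms(1) unfolding totally_real_def by blast
  then have "J ?v' = 0" using eq r by simp
  then have "?v' = 0" using J_J[of ?v'] by (simp add: J_simps(3))
  then show "v1 = v2" "v1' = v2'" "r1 = r2" using r v by simp_all
qed

text \<open>\<open>V\<close> and \<open>J V\<close> meet trivially but need not be orthogonal, so
  \<open>p\<close> and \<open>q\<close> come from uniqueness of the decomposition, which also yields
  linearity and the rules for \<open>J\<close>.\<close>

lemma V_JV_U_projections:
  assumes tr: "totally_real J V"
  obtains p q r where "linear p" "linear q" "linear r"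
    and "\<And>x. p x \<in> V" "\<And>x. q x \<in> V" "\<And>x. r x \<in> U" "\<And>x. x = p x + J (q x) + r x"
    and "\<And>x. p (J x) = - q x" "\<And>x. q (J x) = p x" "\<And>x. r (J x) = J (r x)"
    and "\<And>v. v \<in> V \<Longrightarrow> p v = v \<and> q v = 0 \<and> r v = 0"
    and "\<And>x. x \<in> U \<Longrightarrow> p x = 0 \<and> q x = 0 \<and> r x = x"
proof -
  have "\<forall>x. \<exists>v v' s. v \<in> V \<and> v' \<in> V \<and> s \<in> U \<and> x = v + J v' + s"
    using V_JV_U_decomp by metis
  then obtain p q r where mem: "\<And>x. p x \<in> V" "\<And>x. q x \<in> V" "\<And>x. r x \<in> U"
    and dec: "\<And>x. x = p x + J (q x) + r x"
    by metis
  have uniq: "p x = v \<and> q x = v' \<and> r x = s"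
    if "v \<in> V" "v' \<in> V" "s \<in> U" "x = v + J v' + s" for x v v' s
    using V_JV_U_unique[OF tr mem(1)[of x] mem(2)[of x] mem(3)[of x] that(1-3)] dec[of x] that(4)
    by metis
  have add: "p (x + y) = p x + p y \<and> q (x + y) = q x + q y \<and> r (x + y) = r x + r y" for x y
  proof (rule uniq)
    have "x + y = (p x + J (q x) + r x) + (p y + J (q y) + r y)" using dec by metis
    then show "x + y = p x + p y + J (q x + q y) + (r x + r y)" by (simp add: J_simps)
  qed (use mem in \<open>simp_all add: subspace_add subspace_V subspace_U\<close>)
  have scale: "p (c *\<^sub>R x) = c *\<^sub>R p x \<and> q (c *\<^sub>R x) = c *\<^sub>R q x \<and> r (c *\<^sub>R x) = c *\<^sub>R r x" for c x
  proof (rule uniq)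
    have "c *\<^sub>R x = c *\<^sub>R (p x + J (q x) + r x)" using dec by metis
    then show "c *\<^sub>R x = c *\<^sub>R p x + J (c *\<^sub>R q x) + c *\<^sub>R r x"
      by (simp add: J_simps scaleR_add_right)
  qed (use mem in \<open>simp_all add: subspace_scale subspace_V subspace_U\<close>)
  have J: "p (J x) = - q x \<and> q (J x) = p x \<and> r (J x) = J (r x)" for x
  proof (rule uniq)
    have "J x = J (p x + J (q x) + r x)" using dec by metis
    then show "J x = - q x + J (p x) + J (r x)" by (simp add: J_simps)
  qed (use mem J_in_U in \<open>simp_all add: subspace_neg subspace_V\<close>)
  show ?thesis
  proof (rule that[of p q r])
    show "linear p" "linear q" "linear r"
      by (rule linearI; simp add: add scale)+
    show "p v = v \<and> q v = 0 \<and> r v = 0" if "v \<in> V" for v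
      by (rule uniq) (use that subspace_0[OF subspace_V] subspace_0[OF subspace_U]
        in \<open>simp_all add: J_simps\<close>)
    show "p x = 0 \<and> q x = 0 \<and> r x = x" if "x \<in> U" for x
      by (rule uniq) (use that subspace_0[OF subspace_V] in \<open>simp_all add: J_simps\<close>)
  qed (use mem dec J in blast)+
qed

text \<open>Off \<open>U\<close> the forms \<open>\<mu>\<^sub>i\<close> extend to \<open>a\<^sub>i = \<lambda>\<^sub>i (X\<^sub>i \<bullet> q) + \<mu>\<^sub>i\<close>, where \<open>J q\<close> is the
  \<open>J\<gg>'\<close>-component; in terms of them all brackets are given by one formula.\<close>

lemma normal_form_bracket:
  assumes nf: "normal_form k l X lam mu \<alpha>" and tr: "totally_real J V"
  obtains a \<beta> p where "\<And>i. i \<in> {1..k} \<Longrightarrow> linear (a i)" "\<And>j. j \<in> {1..l} \<Longrightarrow> linear (\<beta> j)"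
    and "linear p"
    and "\<And>i v. i \<in> {1..k} \<Longrightarrow> v \<in> V \<Longrightarrow> a i v = 0 \<and> a i (J v) = lam i * (X i \<bullet> v)"
    and "\<And>j v. j \<in> {1..l} \<Longrightarrow> v \<in> V \<Longrightarrow> \<beta> j v = 0 \<and> \<beta> j (J v) = 0"
    and "\<And>j x. j \<in> {1..l} \<Longrightarrow> x \<in> U \<Longrightarrow> \<beta> j x = \<alpha> j x"
    and "\<And>v. v \<in> V \<Longrightarrow> p v = v \<and> p (J v) = 0"
    and "\<And>x y. br x y = (\<Sum>i\<in>{1..k}. (1 / lam i * wedge (a i) (a i \<circ> J) x y) *\<^sub>R X i)
      + (\<Sum>j\<in>{1..l}. wedge (\<beta> j) (\<beta> j \<circ> J) x y *\<^sub>R X (k + j))"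
proof -
  obtain p q r where lin: "linear p" "linear q" "linear r"
    and mem: "\<And>x. p x \<in> V" "\<And>x. q x \<in> V" "\<And>x. r x \<in> U"
    and dec: "\<And>x. x = p x + J (q x) + r x"
    and pJ: "\<And>x. p (J x) = - q x" "\<And>x. q (J x) = p x" "\<And>x. r (J x) = J (r x)"
    and pV: "\<And>v. v \<in> V \<Longrightarrow> p v = v \<and> q v = 0 \<and> r v = 0"
    and pU: "\<And>x. x \<in> U \<Longrightarrow> p x = 0 \<and> q x = 0 \<and> r x = x"
    by (rule V_JV_U_projections[OF tr]) (rule that)
  have onb: "orthonormal_basis (k + l) X V" and lam: "\<And>i. i \<in> {1..k} \<Longrightarrow> lam i \<noteq> 0"
    and mu: "\<And>i. i \<in> {1..k} \<Longrightarrow> mu i \<in> dual_space U"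
    and \<alpha>: "\<And>j. j \<in> {1..l} \<Longrightarrow> \<alpha> j \<in> dual_space U"
    and nb: "normal_brackets br J U (k + l) k X lam mu"
    and brU: "\<And>Y Z. Y \<in> U \<Longrightarrow> Z \<in> U \<Longrightarrow>
      br Y Z = (\<Sum>i=1..k. (1 / lam i * wedge (mu i) (mu i \<circ> J) Y Z) *\<^sub>R X i)
      + (\<Sum>i=1..l. wedge (\<alpha> i) (\<alpha> i \<circ> J) Y Z *\<^sub>R X (k + i))"
    using nf by (auto simp: normal_form_def)
  have Vspan: "V = span (X ` {1..k + l})" using onb_span[OF onb] by simp
  have XX: "br (X i) (X j) = 0" "br (J (X i)) (J (X j)) = 0"
    "br (J (X i)) (X j) = (if i = j \<and> i \<le> k then lam i *\<^sub>R X i else 0)"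
    if "i \<in> {1..k + l}" "j \<in> {1..k + l}" for i j
    using nb that unfolding normal_brackets_def by blast+
  have YX: "br Y (X i) = (if i \<le> k then mu i Y *\<^sub>R X i else 0)"
    "br Y (J (X i)) = (if i \<le> k then (- mu i (J Y)) *\<^sub>R X i else 0)"
    if "Y \<in> U" "i \<in> {1..k + l}" for Y i
    using nb that unfolding normal_brackets_def by blast+
  have Vext: "f v = g v"
    if "linear f" "linear g" "\<And>i. i \<in> {1..k + l} \<Longrightarrow> f (X i) = g (X i)" "v \<in> V" for f g :: "'a \<Rightarrow> 'a" and v
    using linear_eq_on_span[of f g "X ` {1..k + l}" v] that Vspan by blast
  have coord: "(\<Sum>i\<in>{1..k}. (c i * (X i \<bullet> X j)) *\<^sub>R X i) = (if j \<le> k then c j *\<^sub>R X j else 0)"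
    if j: "j \<in> {1..k + l}" for c j
  proof -
    have "(\<Sum>i\<in>{1..k}. (c i * (X i \<bullet> X j)) *\<^sub>R X i) = (\<Sum>i\<in>{1..k}. if i = j then c j *\<^sub>R X j else 0)"
      by (intro sum.cong refl) (use j onb_inner[OF onb] in auto)
    then show ?thesis using j by simp
  qed
  note lins = linear_br_left linear_br_right linear_compose[OF linear_J linear_br_left, unfolded comp_def]
    linear_compose[OF linear_J linear_br_right, unfolded comp_def] linear_coordinate_sum
  have VV: "br v v' = 0" if "v \<in> V" "v' \<in> V" for v v'
  proof (rule Vext[OF linear_br_left linear_zero _ that(1)])
    fix i assume i: "i \<in> {1..k + l}"
    show "br (X i) v' = 0"
      by (rule Vext[OF linear_br_right linear_zero _ that(2)]) (rule XX(1)[OF i])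
  qed
  have JVJV: "br (J v) (J v') = 0" if "v \<in> V" "v' \<in> V" for v v'
  proof (rule Vext[OF _ linear_zero _ that(1)])
    show "linear (\<lambda>v. br (J v) (J v'))" by (rule lins)
    fix i assume i: "i \<in> {1..k + l}"
    show "br (J (X i)) (J v') = 0"
      by (rule Vext[OF _ linear_zero _ that(2)]) (rule lins, rule XX(2)[OF i])
  qed
  have JVV: "br (J v) v' = (\<Sum>i\<in>{1..k}. ((lam i * (X i \<bullet> v')) * (X i \<bullet> v)) *\<^sub>R X i)"
    if "v \<in> V" "v' \<in> V" for v v'
  proof (rule Vext[OF _ linear_coordinate_sum _ that(1)])
    show "linear (\<lambda>v. br (J v) v')" by (rule lins)
    fix j assume j: "j \<in> {1..k + l}"
    have "br (J (X j)) v' = (\<Sum>i\<in>{1..k}. ((lam i * (X i \<bullet> X j)) * (X i \<bullet> v')) *\<^sub>R X i)"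
    proof (rule Vext[OF linear_br_right linear_coordinate_sum _ that(2)])
      fix i assume i: "i \<in> {1..k + l}"
      show "br (J (X j)) (X i) = (\<Sum>ia\<in>{1..k}. ((lam ia * (X ia \<bullet> X j)) * (X ia \<bullet> X i)) *\<^sub>R X ia)"
        unfolding coord[OF i] using XX(3)[OF j i] onb_inner[OF onb i j] by auto
    qed
    then show "br (J (X j)) v' = (\<Sum>i\<in>{1..k}. ((lam i * (X i \<bullet> v')) * (X i \<bullet> X j)) *\<^sub>R X i)"
      by (simp add: mult.assoc mult.left_commute mult.commute)
  qed
  have YV: "br Y v = (\<Sum>i\<in>{1..k}. (mu i Y * (X i \<bullet> v)) *\<^sub>R X i)" if "Y \<in> U" "v \<in> V" for Y v
    by (rule Vext[OF linear_br_right linear_coordinate_sum _ that(2)])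
      (unfold coord, simp add: YX that(1))
  have YJV: "br Y (J v) = (\<Sum>i\<in>{1..k}. ((- mu i (J Y)) * (X i \<bullet> v)) *\<^sub>R X i)"
    if "Y \<in> U" "v \<in> V" for Y v
    by (rule Vext[OF _ linear_coordinate_sum _ that(2)])
      (unfold coord, simp_all add: YX that(1) lins)

  define a where "a i x = lam i * (X i \<bullet> q x) + mu i (r x)" for i x
  define \<beta> where "\<beta> j x = \<alpha> j (r x)" for j x
  have dual: "linear (\<lambda>x. \<phi> (r x))" if "\<phi> \<in> dual_space U" for \<phi>
    using that mem(3) lin(3)
    by (intro linearI) (simp_all add: dual_space_def linear_add linear_scale)
  have dual0: "\<phi> 0 = 0" if "\<phi> \<in> dual_space U" for \<phi> :: "'a \<Rightarrow> real"
    using linear_0[OF dual[OF that]] linear_0[OF lin(3)] by simp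
  have lina: "linear (a i)" if "i \<in> {1..k}" for i
  proof -
    have "linear (\<lambda>x. lam i * (X i \<bullet> q x))"
      by (rule linearI) (simp_all add: linear_add[OF lin(2)] linear_scale[OF lin(2)] inner_simps
          algebra_simps)
    then show ?thesis
      using linear_compose_add[OF _ dual[OF mu[OF that]]] unfolding a_def by blast
  qed
  have aJ: "a i (J x) = lam i * (X i \<bullet> p x) + mu i (J (r x))" for i x
    by (simp add: a_def pJ)
  have main: "br x y = (\<Sum>i\<in>{1..k}. (1 / lam i * wedge (a i) (a i \<circ> J) x y) *\<^sub>R X i)
      + (\<Sum>j\<in>{1..l}. wedge (\<beta> j) (\<beta> j \<circ> J) x y *\<^sub>R X (k + j))" for x y
  proof -
    have "br x y = br (p x + J (q x) + r x) (p y + J (q y) + r y)"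
      using dec by metis
    also have "\<dots> = br (J (q x)) (p y) - br (J (q y)) (p x) + br (r x) (p y) - br (r y) (p x)
        + br (r x) (J (q y)) - br (r y) (J (q x)) + br (r x) (r y)"
      using VV[OF mem(1)[of x] mem(1)[of y]] JVJV[OF mem(2)[of x] mem(2)[of y]]
        br_swap[of "p x" "J (q y)"] br_swap[of "p x" "r y"] br_swap[of "J (q x)" "r y"]
      by (simp add: br_simps)
    also have "\<dots> = (\<Sum>i\<in>{1..k}. (lam i * (X i \<bullet> p y) * (X i \<bullet> q x)
        - lam i * (X i \<bullet> p x) * (X i \<bullet> q y) + mu i (r x) * (X i \<bullet> p y)
        - mu i (r y) * (X i \<bullet> p x) + (- mu i (J (r x))) * (X i \<bullet> q y)
        - (- mu i (J (r y))) * (X i \<bullet> q x)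
        + 1 / lam i * wedge (mu i) (mu i \<circ> J) (r x) (r y)) *\<^sub>R X i)
      + (\<Sum>j\<in>{1..l}. wedge (\<beta> j) (\<beta> j \<circ> J) x y *\<^sub>R X (k + j))"
      unfolding JVV[OF mem(2) mem(1)] YV[OF mem(3) mem(1)] YJV[OF mem(3) mem(2)] brU[OF mem(3) mem(3)]
        scaleR_add_left scaleR_diff_left sum.distrib sum_subtractf
      by (simp add: wedge_def \<beta>_def pJ)
    \<comment> \<open>The seven terms are the expansion of the wedge of
      \<open>lam i * (X i \<bullet> q x) + mu i (r x)\<close> with
      \<open>lam i * (X i \<bullet> p x) + mu i (J (r x))\<close>, divided by
      \<open>lam i\<close>.\<close>
    also have "(\<Sum>i\<in>{1..k}. (lam i * (X i \<bullet> p y) * (X i \<bullet> q x)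
        - lam i * (X i \<bullet> p x) * (X i \<bullet> q y) + mu i (r x) * (X i \<bullet> p y)
        - mu i (r y) * (X i \<bullet> p x) + (- mu i (J (r x))) * (X i \<bullet> q y)
        - (- mu i (J (r y))) * (X i \<bullet> q x)
        + 1 / lam i * wedge (mu i) (mu i \<circ> J) (r x) (r y)) *\<^sub>R X i)
      = (\<Sum>i\<in>{1..k}. (1 / lam i * wedge (a i) (a i \<circ> J) x y) *\<^sub>R X i)"
      by (intro sum.cong refl arg_cong[where f = "\<lambda>c. c *\<^sub>R X _"])
        (use lam in \<open>simp add: wedge_def aJ, simp add: a_def field_simps\<close>)
    finally show ?thesis .
  qed
  have \<beta>V: "\<beta> j v = 0 \<and> \<beta> j (J v) = 0" if "j \<in> {1..l}" "v \<in> V" for j v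
    using pV[OF that(2)] dual0[OF \<alpha>[OF that(1)]] by (simp add: \<beta>_def pJ J_simps)
  have aV: "a i v = 0 \<and> a i (J v) = lam i * (X i \<bullet> v)" if "i \<in> {1..k}" "v \<in> V" for i v
    using pV[OF that(2)] dual0[OF mu[OF that(1)]] by (simp add: aJ) (simp add: a_def J_simps)
  show ?thesis
  proof (rule that[of a \<beta> p])
    show "linear (\<beta> j)" if "j \<in> {1..l}" for j
      using dual[OF \<alpha>[OF that]] unfolding \<beta>_def .
    show "p v = v \<and> p (J v) = 0" if "v \<in> V" for v using pV[OF that] by (simp add: pJ)
    show "\<beta> j x = \<alpha> j x" if "x \<in> U" for j x using pU[OF that] by (simp add: \<beta>_def)
  qed (use lina lin(1) aV \<beta>V main in blast)+
qed

text \<open>In an orthonormal basis every component of the bracket is a multiple of some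
  \<open>b \<and> b \<circ> J\<close>. Such a form is \<open>J\<close>-invariant, which gives
  \<open>abelian_J\<close>, and decomposable, which gives \<open>cyclic_inner\<close>.\<close>

theorem normal_form_imp_SKT:
  assumes nf: "normal_form k l X lam mu \<alpha>" and tr: "totally_real J V"
  shows "SKT br J"
proof -
  obtain a \<beta> where lin: "\<And>i. i \<in> {1..k} \<Longrightarrow> linear (a i)" "\<And>j. j \<in> {1..l} \<Longrightarrow> linear (\<beta> j)"
    and br: "\<And>x y. br x y = (\<Sum>i\<in>{1..k}. (1 / lam i * wedge (a i) (a i \<circ> J) x y) *\<^sub>R X i)
      + (\<Sum>j\<in>{1..l}. wedge (\<beta> j) (\<beta> j \<circ> J) x y *\<^sub>R X (k + j))"
    by (rule normal_form_bracket[OF nf tr]) (rule that)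
  have onb: "orthonormal_basis (k + l) X V" using nf by (simp add: normal_form_def)
  define b where "b i = (if i \<le> k then a i else \<beta> (i - k))" for i
  define s where "s i = (if i \<le> k then 1 / lam i else 1)" for i
  have linb: "linear (b i)" if "i \<in> {1..k + l}" for i
  proof (cases "i \<le> k")
    case False
    then have "i - k \<in> {1..l}" using that by auto
    then show ?thesis using lin(2) False by (simp add: b_def)
  qed (use lin(1) that in \<open>simp add: b_def\<close>)
  have brb: "br x y = (\<Sum>i\<in>{1..k + l}. (s i * wedge (b i) (b i \<circ> J) x y) *\<^sub>R X i)" for x y
    unfolding br sum_atLeastAtMost_add by (simp add: b_def s_def)
  have "wedge (b i) (b i \<circ> J) (J x) (J y) = wedge (b i) (b i \<circ> J) x y"
    if "i \<in> {1..k + l}" for i x y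
    using linear_neg[OF linb[OF that]] by (simp add: wedge_def J_J)
  then have abelian_J by (simp add: abelian_J_def brb)
  moreover have cyclic_inner
    unfolding cyclic_inner_def
  proof (intro allI)
    fix x y z w
    have inner: "br x y \<bullet> br z w = (\<Sum>i\<in>{1..k + l}. s i * s i *
        (wedge (b i) (b i \<circ> J) x y * wedge (b i) (b i \<circ> J) z w))" for x y z w
    proof -
      have "X i \<bullet> br x y = s i * wedge (b i) (b i \<circ> J) x y" if "i \<in> {1..k + l}" for i x y
        unfolding brb by (rule onb_inner_sum[OF onb that])
      then show ?thesis
        unfolding onb_inner_expand[OF onb br_in_V] by (simp add: mult_ac)
    qed
    show "br x y \<bullet> br z w - br x z \<bullet> br y w + br x w \<bullet> br y z = 0"
      unfolding inner sum_subtractf[symmetric] sum.distrib[symmetric]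
        right_diff_distrib[symmetric] distrib_left[symmetric] wedge_cyclic
      by simp
  qed
  ultimately show ?thesis using SKT_iff[OF tr] by simp
qed

end

section \<open>Independent families of linear functionals and their common kernels\<close>

lemma linear_functional_eq_inner:
  fixes F :: "'a::euclidean_space \<Rightarrow> real"
  assumes "linear F"
  shows "\<exists>z. \<forall>x. F x = z \<bullet> x"
  using adjoint_works[OF assms, of _ 1] by (intro exI[of _ "adjoint F 1"]) (simp add: inner_commute)

lemma indexed_independent:
  fixes g :: "'i \<Rightarrow> 'a::real_vector"
  assumes I: "finite I" and ind: "\<And>c. (\<Sum>t\<in>I. c t *\<^sub>R g t) = 0 \<Longrightarrow> \<forall>t\<in>I. c t = 0"
  shows "inj_on g I" "independent (g ` I)"
proof -
  show inj: "inj_on g I"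
  proof (rule inj_onI, rule ccontr)
    fix s t assume st: "s \<in> I" "t \<in> I" "g s = g t" "s \<noteq> t"
    let ?c = "\<lambda>r. (if r = s then 1 else 0) - (if r = t then 1 else 0) :: real"
    have "(\<Sum>r\<in>I. ?c r *\<^sub>R g r) = (\<Sum>r\<in>I. (if r = s then g r else 0) - (if r = t then g r else 0))"
      by (intro sum.cong refl) (simp add: scaleR_diff_left)
    also have "\<dots> = 0" using st I by (simp add: sum_subtractf)
    finally have "\<forall>r\<in>I. ?c r = 0" by (rule ind)
    then show False using st by (auto dest: bspec[of _ _ s])
  qed
  show "independent (g ` I)"
  proof (rule independent_if_scalars_zero)
    fix f x assume "(\<Sum>x\<in>g ` I. f x *\<^sub>R x) = 0" and x: "x \<in> g ` I"
    then have "(\<Sum>t\<in>I. f (g t) *\<^sub>R g t) = 0" by (simp add: sum.reindex[OF inj])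
    from ind[OF this] show "f x = 0" using x by auto
  qed (use I in simp)
qed

lemma independent_functionals_surj:
  fixes g :: "'i \<Rightarrow> 'a::euclidean_space"
  assumes "finite I" "\<And>c. (\<Sum>t\<in>I. c t *\<^sub>R g t) = 0 \<Longrightarrow> \<forall>t\<in>I. c t = 0"
  obtains y where "\<And>t. t \<in> I \<Longrightarrow> g t \<bullet> y = d t"
proof -
  note ind = indexed_independent[of I g, OF assms]
  obtain F :: "'a \<Rightarrow> real" where F: "linear F" "\<forall>x\<in>g ` I. F x = d (inv_into I g x)"
    using linear_independent_extend[OF ind(2), of "\<lambda>x. d (inv_into I g x)"] by blast
  obtain z where z: "\<forall>x. F x = z \<bullet> x" using linear_functional_eq_inner[OF F(1)] by blast
  have "g t \<bullet> z = d t" if "t \<in> I" for t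
  proof -
    have "F (g t) = d t" using F(2) that inv_into_f_f[OF ind(1) that] by simp
    then show ?thesis using z by (simp add: inner_commute)
  qed
  then show ?thesis by (rule that)
qed

text \<open>Joint surjectivity makes the representing vectors independent: a relation with
  coefficients \<open>c\<close>, tested at a point where \<open>\<Phi> t\<close> takes the value
  \<open>c t\<close>, says that the sum of the squares of \<open>c\<close> is zero.\<close>

lemma dim_common_kernel:
  fixes \<Phi> :: "'i \<Rightarrow> 'a::euclidean_space \<Rightarrow> real"
  assumes I: "finite I" and lin: "\<And>t. t \<in> I \<Longrightarrow> linear (\<Phi> t)"
    and surj: "\<And>c. \<exists>x. \<forall>t\<in>I. \<Phi> t x = c t"
  shows "dim {x. \<forall>t\<in>I. \<Phi> t x = 0} + card I = DIM('a)"
proof -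
  have "\<forall>t\<in>I. \<exists>z. \<forall>x. \<Phi> t x = z \<bullet> x"
    using linear_functional_eq_inner lin by blast
  then obtain g where g: "\<And>t x. t \<in> I \<Longrightarrow> \<Phi> t x = g t \<bullet> x"
    unfolding bchoice_iff by blast
  have ind: "\<forall>t\<in>I. c t = 0" if c: "(\<Sum>t\<in>I. c t *\<^sub>R g t) = 0" for c
  proof -
    obtain x where x: "\<forall>t\<in>I. \<Phi> t x = c t" using surj by blast
    have "(\<Sum>t\<in>I. c t * c t) = (\<Sum>t\<in>I. c t *\<^sub>R g t) \<bullet> x"
      using x g by (simp add: inner_sum_left)
    then have "(\<Sum>t\<in>I. c t * c t) = 0" unfolding c by simp
    then show ?thesis using I by (simp add: sum_nonneg_eq_0_iff)
  qed
  have "{x. \<forall>t\<in>I. \<Phi> t x = 0} = {y \<in> UNIV. \<forall>x\<in>span (g ` I). orthogonal x y}"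
  proof (intro set_eqI iffI)
    fix y assume y: "y \<in> {x. \<forall>t\<in>I. \<Phi> t x = 0}"
    have "orthogonal y x" if "x \<in> span (g ` I)" for x
      by (rule orthogonal_to_span[OF that]) (use y g in \<open>auto simp: orthogonal_def inner_commute\<close>)
    then show "y \<in> {y \<in> UNIV. \<forall>x\<in>span (g ` I). orthogonal x y}" by (simp add: orthogonal_commute)
  next
    fix y assume "y \<in> {y \<in> UNIV. \<forall>x\<in>span (g ` I). orthogonal x y}"
    then show "y \<in> {x. \<forall>t\<in>I. \<Phi> t x = 0}" using g by (auto simp: orthogonal_def span_base)
  qed
  moreover have "dim {y \<in> UNIV. \<forall>x\<in>span (g ` I). orthogonal x y} + dim (span (g ` I)) = DIM('a)"
    using dim_subspace_orthogonal_to_vectors[of "span (g ` I)" "UNIV :: 'a set"] by simp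
  moreover have "dim (span (g ` I)) = card I"
    using indexed_independent[of I g, OF I ind] by (simp add: dim_eq_card_independent card_image)
  ultimately show ?thesis by simp
qed

section \<open>The isomorphism with a direct sum of standard algebras\<close>

context almost_hermitian_lie_algebra
begin

text \<open>The pair \<open>a i\<close>, \<open>a i \<circ> J\<close> gives coordinates of an affine
  summand, where \<open>lam i\<close> cancels; \<open>\<beta> j\<close>,
  \<open>\<beta> j \<circ> J\<close> and the \<open>X (k + j)\<close> coordinate of \<open>p\<close>
  give a Heisenberg summand. Complex independence enters as joint surjectivity of the
  \<open>\<beta> j\<close> and \<open>\<beta> j \<circ> J\<close>.\<close>

theorem normal_form_isomorphic:
  assumes nf: "normal_form k l X lam mu \<alpha>" and ind: "complex_independent J {1..l} \<alpha>"
    and tr: "totally_real J V" and N: "N = DIM('a) - 2 * k - 3 * l"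
  shows "lie_structure br \<cong>\<^sub>L
    lie_copies k aff_real \<oplus>\<^sub>L lie_copies l heisenberg3 \<oplus>\<^sub>L lie_copies N abelian_real"
proof -
  obtain a \<beta> p where lina: "\<And>i. i \<in> {1..k} \<Longrightarrow> linear (a i)" and lin\<beta>: "\<And>j. j \<in> {1..l} \<Longrightarrow> linear (\<beta> j)"
    and linp: "linear p"
    and aV: "\<And>i v. i \<in> {1..k} \<Longrightarrow> v \<in> V \<Longrightarrow> a i v = 0 \<and> a i (J v) = lam i * (X i \<bullet> v)"
    and \<beta>V: "\<And>j v. j \<in> {1..l} \<Longrightarrow> v \<in> V \<Longrightarrow> \<beta> j v = 0 \<and> \<beta> j (J v) = 0"
    and \<beta>U: "\<And>j x. j \<in> {1..l} \<Longrightarrow> x \<in> U \<Longrightarrow> \<beta> j x = \<alpha> j x"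
    and pV: "\<And>v. v \<in> V \<Longrightarrow> p v = v \<and> p (J v) = 0"
    and br: "\<And>x y. br x y = (\<Sum>i\<in>{1..k}. (1 / lam i * wedge (a i) (a i \<circ> J) x y) *\<^sub>R X i)
      + (\<Sum>j\<in>{1..l}. wedge (\<beta> j) (\<beta> j \<circ> J) x y *\<^sub>R X (k + j))"
    by (rule normal_form_bracket[OF nf tr]) (rule that)
  have onb: "orthonormal_basis (k + l) X V" and lam: "\<And>i. i \<in> {1..k} \<Longrightarrow> lam i \<noteq> 0"
    and \<alpha>: "\<And>j. j \<in> {1..l} \<Longrightarrow> \<alpha> j \<in> dual_space U"
    using nf by (auto simp: normal_form_def)

  have brb: "br x y = (\<Sum>i\<in>{1..k + l}. (if i \<le> k then 1 / lam i * wedge (a i) (a i \<circ> J) x y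
      else wedge (\<beta> (i - k)) (\<beta> (i - k) \<circ> J) x y) *\<^sub>R X i)" for x y
    unfolding br sum_atLeastAtMost_add by simp
  have Xbr: "X i \<bullet> br x y = (if i \<le> k then 1 / lam i * wedge (a i) (a i \<circ> J) x y
      else wedge (\<beta> (i - k)) (\<beta> (i - k) \<circ> J) x y)" if "i \<in> {1..k + l}" for i x y
    unfolding brb by (rule onb_inner_sum[OF onb that])

  have \<beta>surj: "\<exists>y. \<forall>j\<in>{1..l}. \<beta> j y = c j \<and> \<beta> j (J y) = d j" for c d
  proof -
    have "\<forall>j\<in>{1..l}. \<exists>z. \<forall>x. \<beta> j x = z \<bullet> x"
      using linear_functional_eq_inner lin\<beta> by blast
    then obtain g where g: "\<And>j x. j \<in> {1..l} \<Longrightarrow> \<beta> j x = g j \<bullet> x"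
      unfolding bchoice_iff by blast
    let ?I = "{1..l} \<times> (UNIV :: bool set)"
    let ?g = "\<lambda>t. if snd t then g (fst t) else - J (g (fst t))"
    have inner_g: "?g t \<bullet> y = (if snd t then \<beta> (fst t) y else \<beta> (fst t) (J y))" if "t \<in> ?I" for t y
      using that by (auto simp: g inner_J_left)
    have "\<forall>t\<in>?I. s t = 0" if s: "(\<Sum>t\<in>?I. s t *\<^sub>R ?g t) = 0" for s
    proof -
      \<comment> \<open>A real relation among the functionals \<open>\<beta> j\<close> and
        \<open>\<beta> j \<circ> J\<close> is a complex relation among the \<open>\<beta> j\<close>;
        the Boolean tags real and imaginary parts.\<close>
      let ?z = "\<lambda>j. Complex (s (j, True)) (s (j, False))"
      have "(\<Sum>j\<in>{1..l}. cscale_form J (?z j) (\<alpha> j)) y = 0" for y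
      proof (cases "y \<in> U")
        case True
        have "(\<Sum>j\<in>{1..l}. cscale_form J (?z j) (\<alpha> j)) y
            = (\<Sum>j\<in>{1..l}. s (j, True) * \<beta> j y + s (j, False) * \<beta> j (J y))"
          unfolding sum_fun_apply
          by (intro sum.cong refl) (simp add: cscale_form_def \<beta>U True J_in_U)
        also have "\<dots> = (\<Sum>j\<in>{1..l}. \<Sum>b\<in>UNIV. s (j, b) * (?g (j, b) \<bullet> y))"
          by (intro sum.cong refl) (simp add: UNIV_bool g inner_J_left add.commute)
        also have "\<dots> = (\<Sum>t\<in>?I. s t * (?g t \<bullet> y))"
          unfolding sum.cartesian_product by (intro sum.cong refl) auto
        also have "\<dots> = (\<Sum>t\<in>?I. s t *\<^sub>R ?g t) \<bullet> y"
          by (simp only: inner_sum_left inner_scaleR_left)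
        finally show ?thesis unfolding s by simp
      next
        case False
        then have "J y \<notin> U" using J_in_U[of "J y"] subspace_neg[OF subspace_U, of "- y"]
          by (auto simp: J_J)
        then show ?thesis
          unfolding sum_fun_apply using False \<alpha>
          by (intro sum.neutral) (auto simp: cscale_form_def dual_space_def)
      qed
      then have "(\<Sum>j\<in>{1..l}. cscale_form J (?z j) (\<alpha> j)) = 0" by (simp only: fun_eq_iff zero_fun_def) simp
      then have z: "\<forall>j\<in>{1..l}. ?z j = 0"
        by (rule ind[unfolded complex_independent_def, rule_format, THEN ballI])
      have "s (j, b) = 0" if "j \<in> {1..l}" for j b
        using bspec[OF z that] by (cases b) (simp_all add: complex_eq_iff)
      then show ?thesis by auto
    qed
    note ind_g = this
    obtain y where y: "\<And>t. t \<in> ?I \<Longrightarrow> ?g t \<bullet> y = (if snd t then c (fst t) else d (fst t))"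
      by (rule independent_functionals_surj[of ?I ?g "\<lambda>t. if snd t then c (fst t) else d (fst t)"])
        (simp, rule ind_g, assumption, rule that)
    have "\<beta> j y = c j \<and> \<beta> j (J y) = d j" if "j \<in> {1..l}" for j
      using y[of "(j, True)"] y[of "(j, False)"] inner_g[of "(j, True)" y] inner_g[of "(j, False)" y]
        that by simp
    then show ?thesis by blast
  qed

  have surj: "\<exists>x. (\<forall>i\<in>{1..k}. a i x = c1 i \<and> a i (J x) = c2 i) \<and>
      (\<forall>j\<in>{1..l}. \<beta> j x = d1 j \<and> \<beta> j (J x) = d2 j \<and> X (k + j) \<bullet> p x = d3 j)" for c1 c2 d1 d2 d3
  proof -
    obtain y where y: "\<And>j. j \<in> {1..l} \<Longrightarrow> \<beta> j y = d1 j \<and> \<beta> j (J y) = d2 j"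
      using \<beta>surj[of d1 d2] by blast
    \<comment> \<open>Adding elements of \<open>V\<close> and \<open>J V\<close> leaves the
      \<open>\<beta> j\<close> unchanged. \<open>J v'\<close> corrects \<open>a i x\<close>, and
      \<open>v\<close> corrects \<open>a i (J x)\<close> and the coordinates in \<open>R\<close>.
      The coefficients of \<open>v'\<close> beyond \<open>k\<close> are never read.\<close>
    define v' where "v' = (\<Sum>i\<in>{1..k + l}. ((c1 i - a i y) / lam i) *\<^sub>R X i)"
    define v where "v = (\<Sum>i\<in>{1..k + l}. (if i \<le> k then (c2 i - a i (J y)) / lam i
        else d3 (i - k) - X i \<bullet> p y) *\<^sub>R X i)"
    have V: "v \<in> V" "v' \<in> V"
      unfolding v_def v'_def
      by (intro subspace_sum subspace_V subspace_scale; use onb_in[OF onb] in blast)+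
    have Xv': "X i \<bullet> v' = (c1 i - a i y) / lam i" if "i \<in> {1..k + l}" for i
      unfolding v'_def by (rule onb_inner_sum[OF onb that])
    have Xv: "X i \<bullet> v = (if i \<le> k then (c2 i - a i (J y)) / lam i else d3 (i - k) - X i \<bullet> p y)"
      if "i \<in> {1..k + l}" for i
      unfolding v_def by (rule onb_inner_sum[OF onb that])
    let ?x = "y + J v' + v"
    have "a i ?x = c1 i \<and> a i (J ?x) = c2 i" if i: "i \<in> {1..k}" for i
      using aV[OF i V(1)] aV[OF i V(2)] i lam[OF i] Xv[of i] Xv'[of i]
      by (simp add: J_simps linear_add[OF lina[OF i]] linear_diff[OF lina[OF i]]
          linear_neg[OF lina[OF i]])
    moreover have "\<beta> j ?x = d1 j \<and> \<beta> j (J ?x) = d2 j \<and> X (k + j) \<bullet> p ?x = d3 j"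
      if j: "j \<in> {1..l}" for j
      using \<beta>V[OF j V(1)] \<beta>V[OF j V(2)] y[OF j] pV[OF V(1)] pV[OF V(2)] Xv[of "k + j"] j
      by (simp add: J_simps linear_add[OF lin\<beta>[OF j]] linear_diff[OF lin\<beta>[OF j]]
          linear_neg[OF lin\<beta>[OF j]] linear_add[OF linp] inner_simps)
    ultimately show ?thesis by blast
  qed

  define K where "K = {x. (\<forall>i\<in>{1..k}. a i x = 0 \<and> a i (J x) = 0) \<and>
    (\<forall>j\<in>{1..l}. \<beta> j x = 0 \<and> \<beta> j (J x) = 0 \<and> X (k + j) \<bullet> p x = 0)}"
  have K: "subspace K"
    using lina lin\<beta> linp
    by (auto simp: K_def subspace_def linear_0 linear_add linear_scale J_simps inner_simps)
  have "dim K = N"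
  proof -
    define I where "I = {0, 1 :: nat} \<times> {1..k} \<union> {2, 3, 4} \<times> {1..l}"
    define \<Phi> where "\<Phi> t x = (if fst t = 0 then a (snd t) x else if fst t = 1 then a (snd t) (J x)
      else if fst t = 2 then \<beta> (snd t) x else if fst t = 3 then \<beta> (snd t) (J x)
      else X (k + snd t) \<bullet> p x)" for t :: "nat \<times> nat" and x
    have lin\<Phi>: "linear (\<Phi> t)" if "t \<in> I" for t
    proof (rule linearI)
      show "\<Phi> t (x + y) = \<Phi> t x + \<Phi> t y" for x y
        using that lina lin\<beta> linp
        by (auto simp: I_def \<Phi>_def linear_add J_simps inner_simps)
      show "\<Phi> t (c *\<^sub>R x) = c *\<^sub>R \<Phi> t x" for c x
        using that lina lin\<beta> linp
        by (auto simp: I_def \<Phi>_def linear_scale J_simps inner_simps)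
    qed
    have "\<exists>x. \<forall>t\<in>I. \<Phi> t x = c t" for c
    proof -
      obtain x where "(\<forall>i\<in>{1..k}. a i x = c (0, i) \<and> a i (J x) = c (1, i)) \<and>
          (\<forall>j\<in>{1..l}. \<beta> j x = c (2, j) \<and> \<beta> j (J x) = c (3, j) \<and> X (k + j) \<bullet> p x = c (4, j))"
        using surj[of "\<lambda>i. c (0, i)" "\<lambda>i. c (1, i)" "\<lambda>i. c (2, i)" "\<lambda>i. c (3, i)" "\<lambda>i. c (4, i)"]
        by blast
      then have "\<forall>t\<in>I. \<Phi> t x = c t" by (auto simp: I_def \<Phi>_def)
      then show ?thesis by blast
    qed
    then have "dim {x. \<forall>t\<in>I. \<Phi> t x = 0} + card I = DIM('a)"
      using lin\<Phi> by (intro dim_common_kernel) (auto simp: I_def)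
    moreover have "{x. \<forall>t\<in>I. \<Phi> t x = 0} = K"
      by (auto simp: I_def \<Phi>_def K_def ball_Un)
    moreover have "card I = 2 * k + 3 * l"
      unfolding I_def by (subst card_Un_disjoint) (auto simp: card_cartesian_product)
    ultimately show ?thesis using N by simp
  qed
  then obtain b where b: "orthonormal_basis N b K"
    using orthonormal_basis_exists[OF K] by metis

  \<comment> \<open>A linear retraction onto \<open>V\<close> that kills \<open>K\<close>. As
    \<open>K\<close> need not be orthogonal to \<open>V\<close>, inner products with
    \<open>b i\<close> may fail to vanish on brackets; subtracting \<open>s x\<close> first makes
    them vanish there and leaves them unchanged on \<open>K\<close>.\<close>
  define s where "s x = (\<Sum>i\<in>{1..k}. (a i (J x) / lam i) *\<^sub>R X i)
    + (\<Sum>j\<in>{1..l}. (X (k + j) \<bullet> p x) *\<^sub>R X (k + j))" for x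
  have sV: "s v = v" if v: "v \<in> V" for v
  proof -
    have "s v = (\<Sum>i\<in>{1..k}. (X i \<bullet> v) *\<^sub>R X i) + (\<Sum>j\<in>{1..l}. (X (k + j) \<bullet> v) *\<^sub>R X (k + j))"
      unfolding s_def using aV[OF _ v] pV[OF v] lam by simp
    also have "\<dots> = v" using onb_expand[OF onb v] unfolding sum_atLeastAtMost_add by simp
    finally show ?thesis .
  qed
  have sK: "s x = 0" if "x \<in> K" for x
    using that by (simp add: s_def K_def)
  have lins: "linear s"
  proof (rule linearI)
    show "s (x + y) = s x + s y" for x y
    proof -
      have "(\<Sum>i\<in>{1..k}. (a i (J (x + y)) / lam i) *\<^sub>R X i)
        = (\<Sum>i\<in>{1..k}. (a i (J x) / lam i) *\<^sub>R X i + (a i (J y) / lam i) *\<^sub>R X i)"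
        by (intro sum.cong refl)
          (simp add: J_simps linear_add[OF lina] add_divide_distrib scaleR_add_left)
      then show ?thesis
        by (simp add: s_def linear_add[OF linp] inner_simps scaleR_add_left sum.distrib)
    qed
    show "s (c *\<^sub>R x) = c *\<^sub>R s x" for c x
    proof -
      have "(\<Sum>i\<in>{1..k}. (a i (J (c *\<^sub>R x)) / lam i) *\<^sub>R X i)
        = (\<Sum>i\<in>{1..k}. c *\<^sub>R (a i (J x) / lam i) *\<^sub>R X i)"
        by (intro sum.cong refl) (simp add: J_simps linear_scale[OF lina])
      then show ?thesis
        by (simp add: s_def linear_scale[OF linp] scaleR_add_right scaleR_sum_right)
    qed
  qed
  define h where "h i x = b i \<bullet> (x - s x)" for i x
  have linh: "h i (x + y) = h i x + h i y" "h i (c *\<^sub>R x) = c * h i x" for i c x y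
    by (simp_all add: h_def linear_add[OF lins] linear_scale[OF lins] inner_simps algebra_simps)
  have hV: "h i v = 0" if "v \<in> V" for i v using sV[OF that] by (simp add: h_def)
  have hK: "h i x = b i \<bullet> x" if "x \<in> K" for i x using sK[OF that] by (simp add: h_def)

  \<comment> \<open>The copies are counted from 0 and the families from 1, hence the shifts.\<close>
  define f where "f x = ((\<lambda>i. if i < k then (a (i + 1) x, a (i + 1) (J x)) else 0),
    (\<lambda>j. if j < l then (\<beta> (j + 1) x, \<beta> (j + 1) (J x), X (k + (j + 1)) \<bullet> p x) else 0),
    (\<lambda>i. if i < N then h (i + 1) x else 0))" for x
  let ?T = "lie_copies k aff_real \<oplus>\<^sub>L lie_copies l heisenberg3 \<oplus>\<^sub>L lie_copies N abelian_real"
  have linf: "linear f"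
    by (rule linearI)
      (auto simp: f_def fun_eq_iff scaleR_fun_def zero_prod_def J_simps inner_simps
        linear_add[OF lina] linear_add[OF lin\<beta>] linear_add[OF linp] linear_scale[OF lina]
        linear_scale[OF lin\<beta>] linear_scale[OF linp] linh)
  have hom: "f (br x y) = lie_bracket ?T (f x) (f y)" for x y
  proof -
    have "a (i + 1) (br x y) = 0 \<and>
        a (i + 1) (J (br x y)) = a (i + 1) x * a (i + 1) (J y) - a (i + 1) (J x) * a (i + 1) y"
      if "i < k" for i
      using that aV[of "i + 1" "br x y"] Xbr[of "i + 1" x y] lam[of "i + 1"]
      by (simp add: wedge_def mult.commute)
    moreover have "\<beta> (j + 1) (br x y) = 0 \<and> \<beta> (j + 1) (J (br x y)) = 0 \<and>
        X (k + (j + 1)) \<bullet> p (br x y)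
          = \<beta> (j + 1) x * \<beta> (j + 1) (J y) - \<beta> (j + 1) (J x) * \<beta> (j + 1) y"
      if "j < l" for j
      using that \<beta>V[of "j + 1" "br x y"] Xbr[of "k + (j + 1)" x y] pV[of "br x y"]
      by (simp add: wedge_def algebra_simps)
    ultimately show ?thesis
      using hV[OF br_in_V[of x y]]
      by (auto simp: f_def lie_sum_def lie_copies_def aff_real_def heisenberg3_def abelian_real_def
          lie_structure_def fun_eq_iff zero_prod_def)
  qed
  have "inj f"
  proof (unfold linear_injective_0[OF linf], intro allI impI)
    fix x assume f0: "f x = 0"
    have 1: "a (i + 1) x = 0 \<and> a (i + 1) (J x) = 0" if "i < k" for i
      using fun_cong[OF arg_cong[OF f0, of fst], of i] that by (simp add: f_def zero_prod_def)
    have 2: "\<beta> (j + 1) x = 0 \<and> \<beta> (j + 1) (J x) = 0 \<and> X (k + (j + 1)) \<bullet> p x = 0" if "j < l" for j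
      using fun_cong[OF arg_cong[OF f0, of "fst \<circ> snd"], of j] that by (simp add: f_def zero_prod_def)
    have 3: "h (i + 1) x = 0" if "i < N" for i
      using fun_cong[OF arg_cong[OF f0, of "snd \<circ> snd"], of i] that by (simp add: f_def zero_prod_def)
    have xK: "x \<in> K"
      unfolding K_def
    proof (intro CollectI conjI ballI)
      fix i assume "i \<in> {1..k}"
      then show "a i x = 0" "a i (J x) = 0" using 1[of "i - 1"] by auto
    next
      fix j assume "j \<in> {1..l}"
      then show "\<beta> j x = 0" "\<beta> j (J x) = 0" "X (k + j) \<bullet> p x = 0" using 2[of "j - 1"] by auto
    qed
    have "b i \<bullet> x = b i \<bullet> 0" if "i \<in> {1..N}" for i
      using that 3[of "i - 1"] hK[OF xK, of i] by auto
    then show "x = 0" using onb_eqI[OF b xK subspace_0[OF K]] by blast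
  qed
  moreover have "f ` UNIV = lie_carrier ?T"
  proof (intro equalityI subsetI)
    fix z assume "z \<in> f ` UNIV"
    then show "z \<in> lie_carrier ?T"
      by (auto simp: f_def lie_sum_def lie_copies_def aff_real_def heisenberg3_def abelian_real_def
          lie_structure_def)
  next
    fix z assume z: "z \<in> lie_carrier ?T"
    obtain z1 z2 z3 where z123: "z = (z1, z2, z3)" by (cases z)
    have out: "\<forall>i\<ge>k. z1 i = 0" "\<forall>i\<ge>l. z2 i = 0" "\<forall>i\<ge>N. z3 i = 0"
      using z by (auto simp: z123 lie_sum_def lie_copies_def)
    obtain x where x: "\<And>i. i \<in> {1..k} \<Longrightarrow> a i x = fst (z1 (i - 1)) \<and> a i (J x) = snd (z1 (i - 1))"
      "\<And>j. j \<in> {1..l} \<Longrightarrow> \<beta> j x = fst (z2 (j - 1)) \<and> \<beta> j (J x) = fst (snd (z2 (j - 1))) \<and>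
        X (k + j) \<bullet> p x = snd (snd (z2 (j - 1)))"
      using surj[of "\<lambda>i. fst (z1 (i - 1))" "\<lambda>i. snd (z1 (i - 1))" "\<lambda>i. fst (z2 (i - 1))"
          "\<lambda>i. fst (snd (z2 (i - 1)))" "\<lambda>i. snd (snd (z2 (i - 1)))"] by blast
    define y where "y = (\<Sum>i\<in>{1..N}. (z3 (i - 1) - h i x) *\<^sub>R b i)"
    have yK: "y \<in> K"
      unfolding y_def by (intro subspace_sum K subspace_scale) (use onb_in[OF b] in blast)
    have "b i \<bullet> y = z3 (i - 1) - h i x" if "i \<in> {1..N}" for i
      unfolding y_def by (rule onb_inner_sum[OF b that])
    then have h: "h i (x + y) = z3 (i - 1)" if "i \<in> {1..N}" for i
      using that by (simp add: linh hK[OF yK])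
    have fy: "a i y = 0" "a i (J y) = 0" if "i \<in> {1..k}" for i
      using yK that by (auto simp: K_def)
    have fy': "\<beta> j y = 0" "\<beta> j (J y) = 0" "X (k + j) \<bullet> p y = 0" if "j \<in> {1..l}" for j
      using yK that by (auto simp: K_def)
    have "f (x + y) = z"
    proof -
      have "(if i < k then (a (i + 1) (x + y), a (i + 1) (J (x + y))) else 0) = z1 i" for i
        using x(1)[of "i + 1"] fy[of "i + 1"] out(1) linear_add[OF lina[of "i + 1"]]
        by (auto simp: J_simps)
      moreover have "(if j < l then (\<beta> (j + 1) (x + y), \<beta> (j + 1) (J (x + y)),
          X (k + (j + 1)) \<bullet> p (x + y)) else 0) = z2 j" for j
        using x(2)[of "j + 1"] fy'[of "j + 1"] out(2) linear_add[OF lin\<beta>[of "j + 1"]]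
        by (auto simp: J_simps linear_add[OF linp] inner_simps)
      moreover have "(if i < N then h (i + 1) (x + y) else 0) = z3 i" for i
        using h[of "i + 1"] out(3) by auto
      ultimately show ?thesis by (simp add: f_def z123)
    qed
    then show "z \<in> f ` UNIV" by blast
  qed
  ultimately have "bij_betw f UNIV (lie_carrier ?T)" by (simp add: bij_betw_def)
  then show ?thesis
    unfolding lie_isomorphic_def using linf hom
    by (intro exI[of _ f]) (simp add: lie_structure_def)
qed

end

lemma lie_copies_one_isomorphic:
  "A \<oplus>\<^sub>L lie_copies 1 L \<oplus>\<^sub>L B \<cong>\<^sub>L A \<oplus>\<^sub>L L \<oplus>\<^sub>L B"
proof -
  let ?f = "\<lambda>z. (fst z, fst (snd z) 0, snd (snd z))"
  let ?S = "A \<oplus>\<^sub>L lie_copies 1 L \<oplus>\<^sub>L B" and ?T = "A \<oplus>\<^sub>L L \<oplus>\<^sub>L B"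
  have "linear ?f"
    by (rule linearI) (simp_all add: scaleR_fun_def)
  moreover have "bij_betw ?f (lie_carrier ?S) (lie_carrier ?T)"
  proof (rule bij_betw_byWitness[where f' = "\<lambda>z. (fst z, (\<lambda>i. if i = 0 then fst (snd z) else 0), snd (snd z))"])
  qed (auto simp: lie_sum_def lie_copies_def fun_eq_iff)
  ultimately show ?thesis
    unfolding lie_isomorphic_def
    by (intro exI[of _ ?f]) (simp add: lie_sum_def lie_copies_def)
qed

lemma lie_isomorphic_trans:
  assumes "L \<cong>\<^sub>L M" "M \<cong>\<^sub>L N"
  shows "L \<cong>\<^sub>L N"
proof -
  obtain f where f: "linear f" "bij_betw f (lie_carrier L) (lie_carrier M)"
    "\<forall>x\<in>lie_carrier L. \<forall>y\<in>lie_carrier L. f (lie_bracket L x y) = lie_bracket M (f x) (f y)"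
    using assms(1) unfolding lie_isomorphic_def by blast
  obtain g where g: "linear g" "bij_betw g (lie_carrier M) (lie_carrier N)"
    "\<forall>x\<in>lie_carrier M. \<forall>y\<in>lie_carrier M. g (lie_bracket M x y) = lie_bracket N (g x) (g y)"
    using assms(2) unfolding lie_isomorphic_def by blast
  show ?thesis
    unfolding lie_isomorphic_def
  proof (intro exI[of _ "g \<circ> f"] conjI ballI)
    show "linear (g \<circ> f)" by (rule linear_compose[OF f(1) g(1)])
    show "bij_betw (g \<circ> f) (lie_carrier L) (lie_carrier N)" by (rule bij_betw_trans[OF f(2) g(2)])
    show "(g \<circ> f) (lie_bracket L x y) = lie_bracket N ((g \<circ> f) x) ((g \<circ> f) y)"
      if "x \<in> lie_carrier L" "y \<in> lie_carrier L" for x y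
      using that f(3) g(3) bij_betwE[OF f(2)] by simp
  qed
qed

context almost_hermitian_lie_algebra
begin

lemma SKT_normal_form:
  assumes "two_step_solvable br" and tr: "totally_real J V" and "SKT br J"
    and "dim V = dim (bracket_span br V (J ` V)) + l" "l \<in> {1, 2}"
  obtains X lam mu \<alpha> where "normal_form (dim (bracket_span br V (J ` V))) l X lam mu \<alpha>"
    "complex_independent J {1..l} \<alpha>"
proof -
  interpret abelian_cyclic br J
    using assms(1,3) SKT_iff[OF tr] by unfold_locales auto
  show ?thesis using normal_form_exists[OF assms(4,5)] that by blast
qed

end

theorem theorem5p9:
  fixes br :: "'a::euclidean_space \<Rightarrow> 'a \<Rightarrow> 'a" and J :: "'a \<Rightarrow> 'a" and n m l :: nat
  assumes "almost_hermitian_lie_algebra br J"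
    and "DIM('a) = 2 * n"
    and "two_step_solvable br"
    and "totally_real J (commutator_ideal br)"
    and "dim (commutator_ideal br) = m"
    and "dim (bracket_span br (commutator_ideal br) (J ` commutator_ideal br)) + l = m"
    and "l \<in> {1, 2}"
  shows "(l = 1 \<longrightarrow>
      (SKT br J \<longleftrightarrow>
        (\<exists>X lam mu \<alpha>.
          orthonormal_basis m X (commutator_ideal br) \<and>
          (\<forall>i\<in>{1..m-1}. lam i \<noteq> 0 \<and> mu i \<in> dual_space (U_J br J)) \<and>
          \<alpha> \<in> dual_space (U_J br J) \<and> \<alpha> \<noteq> 0 \<and>
          normal_brackets br J (U_J br J) m (m - 1) X lam mu \<and>
          (\<forall>Y\<in>U_J br J. \<forall>Z\<in>U_J br J.
            br Y Z = (\<Sum>i=1..m-1. (1 / lam i * wedge (mu i) (mu i \<circ> J) Y Z) *\<^sub>R X i)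
              + wedge \<alpha> (\<alpha> \<circ> J) Y Z *\<^sub>R X m))) \<and>
      (SKT br J \<longrightarrow>
        lie_structure br \<cong>\<^sub>L
          lie_copies (m - 1) aff_real \<oplus>\<^sub>L heisenberg3 \<oplus>\<^sub>L
          lie_copies (2 * n - 2 * m - 1) abelian_real)) \<and>
    (l = 2 \<longrightarrow>
      (SKT br J \<longleftrightarrow>
        (\<exists>X lam mu \<alpha>.
          orthonormal_basis m X (commutator_ideal br) \<and>
          (\<forall>i\<in>{1..m-2}. lam i \<noteq> 0 \<and> mu i \<in> dual_space (U_J br J)) \<and>
          (\<forall>i\<in>{1..2}. \<alpha> i \<in> dual_space (U_J br J)) \<and>
          complex_independent J {1..2} \<alpha> \<and>
          normal_brackets br J (U_J br J) m (m - 2) X lam mu \<and>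
          (\<forall>Y\<in>U_J br J. \<forall>Z\<in>U_J br J.
            br Y Z = (\<Sum>i=1..m-2. (1 / lam i * wedge (mu i) (mu i \<circ> J) Y Z) *\<^sub>R X i)
              + (\<Sum>i=1..2. wedge (\<alpha> i) (\<alpha> i \<circ> J) Y Z *\<^sub>R X (m - 2 + i))))) \<and>
      (SKT br J \<longrightarrow>
        lie_structure br \<cong>\<^sub>L
          lie_copies (m - 2) aff_real \<oplus>\<^sub>L lie_copies 2 heisenberg3 \<oplus>\<^sub>L
          lie_copies (2 * n - 2 * m - 2) abelian_real))"
proof -
  interpret almost_hermitian_lie_algebra br J by fact
  define k where "k = dim (bracket_span br V (J ` V))"
  have m: "m = k + l" using assms(6) by (simp add: k_def)
  have nf: "\<exists>X lam mu \<alpha>. normal_form k l X lam mu \<alpha> \<and> complex_independent J {1..l} \<alpha>" if "SKT br J"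
    using SKT_normal_form[OF assms(3,4) that _ assms(7)] assms(5,6) unfolding k_def by metis
  have iso: "lie_structure br \<cong>\<^sub>L lie_copies k aff_real \<oplus>\<^sub>L lie_copies l heisenberg3 \<oplus>\<^sub>L
      lie_copies (2 * n - 2 * m - l) abelian_real" if SKT: "SKT br J"
  proof -
    obtain X lam mu \<alpha> where "normal_form k l X lam mu \<alpha>" "complex_independent J {1..l} \<alpha>"
      using nf[OF SKT] by blast
    \<comment> \<open>With \<open>m = k + l\<close>, \<open>2 * n - 2 * k - 3 * l\<close> equals
      \<open>2 * n - 2 * m - l\<close>, also for truncated subtraction.\<close>
    then show ?thesis
      by (rule normal_form_isomorphic[OF _ _ assms(4)]) (simp add: assms(2) m)
  qed
  show ?thesis
  proof (intro conjI impI)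
    assume l: "l = 1"
    have k: "m - 1 = k" "m = k + 1" using m l by simp_all
    show "SKT br J \<longleftrightarrow> (\<exists>X lam mu \<alpha>.
          orthonormal_basis m X (commutator_ideal br) \<and>
          (\<forall>i\<in>{1..m-1}. lam i \<noteq> 0 \<and> mu i \<in> dual_space (U_J br J)) \<and>
          \<alpha> \<in> dual_space (U_J br J) \<and> \<alpha> \<noteq> 0 \<and>
          normal_brackets br J (U_J br J) m (m - 1) X lam mu \<and>
          (\<forall>Y\<in>U_J br J. \<forall>Z\<in>U_J br J.
            br Y Z = (\<Sum>i=1..m-1. (1 / lam i * wedge (mu i) (mu i \<circ> J) Y Z) *\<^sub>R X i)
              + wedge \<alpha> (\<alpha> \<circ> J) Y Z *\<^sub>R X m))" (is "_ \<longleftrightarrow> (\<exists>X lam mu \<alpha>. ?P X lam mu \<alpha>)")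
    proof
      assume "SKT br J"
      then obtain X lam mu \<alpha> where nf1: "normal_form k 1 X lam mu \<alpha>"
        and ind: "complex_independent J {1..1} \<alpha>" using nf l by blast
      have "\<alpha> 1 \<noteq> 0"
      proof
        assume "\<alpha> 1 = 0"
        then have "(\<Sum>i\<in>{1..1}. cscale_form J ((\<lambda>_. 1) i) (\<alpha> i)) = 0"
          by (simp add: cscale_form_def fun_eq_iff)
        from ind[unfolded complex_independent_def, rule_format, OF this] show False by simp
      qed
      then have "?P X lam mu (\<alpha> 1)" using nf1 unfolding normal_form_def k by simp
      then show "\<exists>X lam mu \<alpha>. ?P X lam mu \<alpha>" by blast
    next
      assume "\<exists>X lam mu \<alpha>. ?P X lam mu \<alpha>"
      then obtain X lam mu \<alpha> where P: "?P X lam mu \<alpha>" by blast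
      \<comment> \<open>Only index 1 of the family is read, so a constant family serves.\<close>
      then have "normal_form k 1 X lam mu (\<lambda>_. \<alpha>)" unfolding normal_form_def k by simp
      then show "SKT br J" by (rule normal_form_imp_SKT[OF _ assms(4)])
    qed
    assume "SKT br J"
    from lie_isomorphic_trans[OF iso[OF this, unfolded l] lie_copies_one_isomorphic]
    show "lie_structure br \<cong>\<^sub>L lie_copies (m - 1) aff_real \<oplus>\<^sub>L heisenberg3 \<oplus>\<^sub>L
        lie_copies (2 * n - 2 * m - 1) abelian_real"
      unfolding k(1) .
  next
    assume l: "l = 2"
    have k: "m - 2 = k" "m = k + 2" using m l by simp_all
    show "SKT br J \<longleftrightarrow> (\<exists>X lam mu \<alpha>.
          orthonormal_basis m X (commutator_ideal br) \<and>
          (\<forall>i\<in>{1..m-2}. lam i \<noteq> 0 \<and> mu i \<in> dual_space (U_J br J)) \<and>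
          (\<forall>i\<in>{1..2}. \<alpha> i \<in> dual_space (U_J br J)) \<and>
          complex_independent J {1..2} \<alpha> \<and>
          normal_brackets br J (U_J br J) m (m - 2) X lam mu \<and>
          (\<forall>Y\<in>U_J br J. \<forall>Z\<in>U_J br J.
            br Y Z = (\<Sum>i=1..m-2. (1 / lam i * wedge (mu i) (mu i \<circ> J) Y Z) *\<^sub>R X i)
              + (\<Sum>i=1..2. wedge (\<alpha> i) (\<alpha> i \<circ> J) Y Z *\<^sub>R X (m - 2 + i))))"
      (is "_ \<longleftrightarrow> (\<exists>X lam mu \<alpha>. ?P X lam mu \<alpha>)")
    proof -
      have P: "?P X lam mu \<alpha> \<longleftrightarrow> normal_form k 2 X lam mu \<alpha> \<and> complex_independent J {1..2} \<alpha>"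
        for X lam mu \<alpha>
        unfolding normal_form_def k(1) unfolding k(2) by blast
      show ?thesis
        unfolding P using nf[unfolded l] normal_form_imp_SKT[OF _ assms(4)] by blast
    qed
    assume "SKT br J"
    from iso[OF this, unfolded l]
    show "lie_structure br \<cong>\<^sub>L lie_copies (m - 2) aff_real \<oplus>\<^sub>L lie_copies 2 heisenberg3 \<oplus>\<^sub>L
        lie_copies (2 * n - 2 * m - 2) abelian_real"
      unfolding k(1) .
  qed
qed

end
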